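(* Every finite graph $G$ has a cycle $C$ such that either $|G\setminus C|=0$ or $$\Delta(G\setminus C)\leq \tfrac{1}{2}\bigl(|G\setminus C|-1\bigr).$$
   Context: A single vertex, a single edge, and the empty set are all considered to be cycles. For a subgraph $C$ of $G$, $G\setminus C$ denotes the induced subgraph of $G$ on $V(G)\setminus V(C)$, so $|G\setminus C|=|V(G)|-|V(C)|$ and $\Delta(G\setminus C)$ is the maximum degree of this induced subgraph. *)

theory Defs
  imports Complex_Main "Graph_Theory.Digraph_Component"
begin

text \<open>
  A finite simple undirected graph is a \<^locale>\<open>graph\<close>: each edge is a pair of
  opposite arcs. Accordingly a cycle is itself a \<^locale>\<open>graph\<close> and contains both
  orientations of each of its edges.

  The library predicate \<^const>\<open>pre_digraph.cycle\<close> on arc lists accepts the closed walk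
  \<open>a, b, a\<close>, hence the explicit lower bound on the length in \<open>proper_cycle\<close>.
\<close>

definition proper_cycle :: "('a, 'b) pre_digraph \<Rightarrow> bool" where
  "proper_cycle C \<longleftrightarrow> graph C \<and>
     (\<exists>p. pre_digraph.cycle C p \<and> 3 \<le> length p \<and>
          verts C = head C ` set p \<and>
          arcs_ends C = arc_to_ends C ` set p \<union> (arc_to_ends C ` set p)\<inverse>)"

definition single_vertex :: "('a, 'b) pre_digraph \<Rightarrow> bool" where
  "single_vertex C \<longleftrightarrow> graph C \<and> (\<exists>v. verts C = {v} \<and> arcs C = {})"

definition single_edge :: "('a, 'b) pre_digraph \<Rightarrow> bool" where
  "single_edge C \<longleftrightarrow> graph C \<and>
     (\<exists>u v. u \<noteq> v \<and> verts C = {u, v} \<and> arcs_ends C = {(u, v), (v, u)})"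

definition empty_graph :: "('a, 'b) pre_digraph \<Rightarrow> bool" where
  "empty_graph C \<longleftrightarrow> graph C \<and> verts C = {} \<and> arcs C = {}"

definition is_cycle :: "('a, 'b) pre_digraph \<Rightarrow> bool" where
  "is_cycle C \<longleftrightarrow> proper_cycle C \<or> single_vertex C \<or> single_edge C \<or> empty_graph C"

definition graph_minus :: "('a, 'b) pre_digraph \<Rightarrow> ('a, 'b) pre_digraph \<Rightarrow> ('a, 'b) pre_digraph"
  where "graph_minus G C = G \<restriction> (verts G - verts C)"

definition graph_order :: "('a, 'b) pre_digraph \<Rightarrow> nat" where
  "graph_order G = card (verts G)"

text \<open>
  In a \<^locale>\<open>graph\<close> the out-degree is the undirected degree. The maximum is meaningful only
  for a nonempty vertex set.
\<close>

definition max_degree :: "('a, 'b) pre_digraph \<Rightarrow> nat" where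
  "max_degree G = Max (out_degree G ` verts G)"

end

theory Submission
  imports Defs
begin

text \<open>
  Suppose that every cycle leaves a vertex adjacent to at least half of the remaining vertices; call
  such a vertex bad. A path missing \<open>2 h\<close> vertices, whose ends both have at least \<open>h\<close> neighbours
  off the path and together more than \<open>2 h\<close>, closes up through a common neighbour of its ends.
  The bad vertex of the resulting cycle can be used to prolong the path to one of the same kind with
  a smaller \<open>h\<close>: either directly, or after a counting argument over all bad vertices, or after
  inserting a sequence of bad vertices that are joined to all but at most one vertex of one half of
  what remains. By descent, no such path exists.

  If the number \<open>n\<close> of vertices is odd, a bad vertex for the empty cycle is already such a path. If
  \<open>n = 2 k\<close>, the absence of such paths makes the graph look bipartite around its vertices of large
  degree. When some degree exceeds \<open>k\<close>, or two of three independent vertices of degree \<open>k\<close> have a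
  common neighbour not adjacent to the third, an alternating path is prolonged by bad vertices until the rest splits into
  two parts of nearly equal size without edges between them; exchanging one early link of the path
  then balances the parts. Otherwise the vertices of degree \<open>k\<close> induce a complete bipartite graph
  and split the vertex set into two halves, and a cycle alternating between them can be enlarged
  as long as it is not spanning.
\<close>

section \<open>Counting\<close>

lemma card_gt_imp_inter_nonempty:
  assumes "finite S" "A \<subseteq> S" "B \<subseteq> S" "card S < card A + card B"
  shows "A \<inter> B \<noteq> {}"
proof
  assume "A \<inter> B = {}"
  then have "card A + card B = card (A \<union> B)"
    using assms by (simp add: card_Un_disjoint finite_subset)
  also have "\<dots> \<le> card S" using assms by (intro card_mono) auto
  finally show False using assms by simp
qed

lemma card_inter_lower_bound:
  assumes "finite S" "A \<subseteq> S" "B \<subseteq> S"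
  shows "card A + card B \<le> card S + card (A \<inter> B)"
proof -
  have "card A + card B = card (A \<union> B) + card (A \<inter> B)"
    using assms by (intro card_Un_Int) (auto intro: finite_subset)
  moreover have "card (A \<union> B) \<le> card S" using assms by (intro card_mono) auto
  ultimately show ?thesis by simp
qed

text \<open>Double counting of incidences. A least subfamily that still misses every point of
  \<open>J\<close> has distinct traces on \<open>J\<close>, so its members are disjoint outside
  \<open>J\<close> and lack the room to have \<open>h\<close> points each.\<close>

lemma no_small_family_of_large_sets:
  fixes Z :: "'a \<Rightarrow> 'a set"
  assumes W: "finite W" "card W = 2 * h" and J: "J \<subseteq> W" "card J \<le> h" "J \<noteq> {}"
    and T: "T \<subseteq> W" "T \<inter> J = {}"
    and Z: "\<And>t. t \<in> T \<Longrightarrow> Z t \<subseteq> W - T" "\<And>t. t \<in> T \<Longrightarrow> card (Z t) = h"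
      "\<And>t. t \<in> T \<Longrightarrow> Z t \<inter> J \<noteq> {}"
    and miss: "\<And>y. y \<in> J \<Longrightarrow> \<exists>t\<in>T. y \<notin> Z t"
    and inter: "\<And>t t'. t \<in> T \<Longrightarrow> t' \<in> T \<Longrightarrow> Z t \<inter> J \<noteq> Z t' \<inter> J \<Longrightarrow> Z t \<inter> Z t' \<subseteq> J"
  shows False
proof -
  let ?Q = "\<lambda>S. S \<subseteq> T \<and> (\<forall>y\<in>J. \<exists>t\<in>S. y \<notin> Z t)"
  have "?Q T" using miss by auto
  then obtain S where S: "?Q S" and least: "\<And>S'. ?Q S' \<Longrightarrow> card S \<le> card S'"
    using ex_has_least_nat[of ?Q T card] by blast
  have finS: "finite S" using S T W by (meson finite_subset)
  have distinct_traces: "Z t \<inter> J \<noteq> Z t' \<inter> J" if "t \<in> S" "t' \<in> S" "t \<noteq> t'" for t t'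
  proof
    assume eq: "Z t \<inter> J = Z t' \<inter> J"
    have "?Q (S - {t'})"
    proof (intro conjI ballI)
      show "S - {t'} \<subseteq> T" using S by blast
      fix y assume y: "y \<in> J"
      then obtain s where s: "s \<in> S" "y \<notin> Z s" using S by blast
      show "\<exists>t\<in>S - {t'}. y \<notin> Z t"
      proof (cases "s = t'")
        case True
        then have "y \<notin> Z t" using s y eq by blast
        then show ?thesis using that by blast
      qed (use s in blast)
    qed
    then show False using least[of "S - {t'}"] finS that by (metis card_Diff1_less leD)
  qed
  obtain y0 where y0: "y0 \<in> J" using J by auto
  then obtain t0 where t0: "t0 \<in> S" using S by blast
  obtain y1 where "y1 \<in> J" "y1 \<in> Z t0" using Z(3)[of t0] S t0 by auto
  then obtain t1 where t1: "t1 \<in> S" "t1 \<noteq> t0" using S by blast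
  have k2: "2 \<le> card S" using t0 t1 finS card_mono[of S "{t0, t1}"] by auto
  \<comment> \<open>A point of \<open>J\<close> is missed by some member, a point of
    \<open>S\<close> lies in none because every \<open>Z t\<close> avoids \<open>T\<close>, and any
    other point lies in at most one.\<close>
  have le: "card {t \<in> S. w \<in> Z t} \<le> (if w \<in> J then card S - 1 else if w \<in> S then 0 else 1)"
    if w: "w \<in> W" for w
  proof -
    consider "w \<in> J" | "w \<notin> J" "w \<in> S" | "w \<notin> J" "w \<notin> S" by blast
    then show ?thesis
    proof cases
      case 1
      then obtain t where "t \<in> S" "w \<notin> Z t" using S by blast
      then have "{t \<in> S. w \<in> Z t} \<subseteq> S - {t}" by auto
      then have "card {t \<in> S. w \<in> Z t} \<le> card (S - {t})" using finS by (intro card_mono) auto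
      with 1 \<open>t \<in> S\<close> finS show ?thesis by simp
    next
      case 2
      then have e: "{t \<in> S. w \<in> Z t} = {}" using Z(1) S by blast
      show ?thesis unfolding e by simp
    next
      case 3
      have "t = t'" if "t \<in> S" "t' \<in> S" "w \<in> Z t" "w \<in> Z t'" for t t'
        using that inter[of t t'] distinct_traces[of t t'] S 3 by blast
      then have "card {t \<in> S. w \<in> Z t} \<le> Suc 0" using finS by (auto simp: card_le_Suc0_iff_eq)
      with 3 show ?thesis by simp
    qed
  qed
  have "card S * h = (\<Sum>t\<in>S. card (Z t))" using Z(2) S by (simp add: subset_eq)
  also have "\<dots> = (\<Sum>t\<in>S. \<Sum>w\<in>W. of_bool (w \<in> Z t))"
  proof (rule sum.cong)
    fix t assume "t \<in> S"
    then have "W \<inter> {w. w \<in> Z t} = Z t" using Z(1) S by blast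
    then show "card (Z t) = (\<Sum>w\<in>W. of_bool (w \<in> Z t))" using W by (simp add: sum_of_bool_eq)
  qed simp
  also have "\<dots> = (\<Sum>w\<in>W. \<Sum>t\<in>S. of_bool (w \<in> Z t))" by (rule sum.swap)
  also have "\<dots> = (\<Sum>w\<in>W. card {t \<in> S. w \<in> Z t})"
    using finS by (simp add: sum_of_bool_eq Int_def)
  also have "\<dots> \<le> (\<Sum>w\<in>W. if w \<in> J then card S - 1 else if w \<in> S then 0 else 1)"
    using le by (rule sum_mono)
  also have "\<dots> = (\<Sum>w\<in>J. card S - 1) + (\<Sum>w\<in>W - J. if w \<in> S then 0 else 1)"
    using W J by (subst sum.subset_diff[of J]) (auto intro!: sum.cong)
  also have "(\<Sum>w\<in>W - J. if w \<in> S then 0 else 1) = card (W - J - S)"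
  proof -
    have "(\<Sum>w\<in>W - J. if w \<in> S then 0 else 1) = (\<Sum>w\<in>W - J. of_bool (w \<notin> S))"
      by (intro sum.cong) auto
    also have "\<dots> = card ((W - J) \<inter> {w. w \<notin> S})" using W by (simp add: sum_of_bool_eq)
    also have "(W - J) \<inter> {w. w \<notin> S} = W - J - S" by auto
    finally show ?thesis .
  qed
  also have "card (W - J - S) = 2 * h - card J - card S"
    using W J T S finS by (subst card_Diff_subset) (auto simp: card_Diff_subset finite_subset)
  finally have main: "card S * h \<le> (card S - 1) * card J + (2 * h - card J - card S)"
    by (simp add: mult.commute)
  have "card (J \<union> S) \<le> card W" using W J S T by (intro card_mono) auto
  then have "card J + card S \<le> 2 * h"
    using W J S T finS by (subst (asm) card_Un_disjoint) (auto intro: finite_subset)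
  \<comment> \<open>Writing \<open>card S\<close> as \<open>k + 2\<close> removes the truncated
    subtraction. The points of \<open>S\<close>, contained in no member, leave the surplus
    \<open>k + 2\<close>, which contradicts \<open>card J \<le> h\<close>.\<close>
  moreover obtain k where k: "card S = k + 2" using k2 by (metis add.commute le_Suc_ex)
  moreover have kJ: "k * card J \<le> k * h" using J by simp
  ultimately have "(k + 2) * h + card J + (k + 2) \<le> (k + 1) * card J + 2 * h"
    using main by simp
  then have "k * h + (k + 2) \<le> k * card J" by (simp add: algebra_simps)
  with kJ show False by linarith
qed

section \<open>Paths with ends of large degree\<close>

locale finite_graph =
  fixes V :: "'a set" and adj :: "'a \<Rightarrow> 'a \<Rightarrow> bool"
  assumes finite_V: "finite V"
    and adj_sym: "adj x y \<Longrightarrow> adj y x"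
    and adj_irrefl [simp]: "\<not> adj x x"
begin

lemma adj_commute: "adj x y \<longleftrightarrow> adj y x"
  using adj_sym by blast

definition nb :: "'a \<Rightarrow> 'a set \<Rightarrow> 'a set" where
  "nb x S = {y \<in> S. adj x y}"

definition dg :: "'a \<Rightarrow> 'a set \<Rightarrow> nat" where
  "dg x S = card (nb x S)"

definition is_path :: "'a list \<Rightarrow> bool" where
  "is_path xs \<longleftrightarrow> distinct xs \<and> set xs \<subseteq> V \<and> successively adj xs"

text \<open>Lists of length 0, 1 and 2 represent the empty set, a vertex and an edge.\<close>

definition closed_path :: "'a list \<Rightarrow> bool" where
  "closed_path xs \<longleftrightarrow> is_path xs \<and> (length xs \<le> 1 \<or> adj (last xs) (hd xs))"

lemma in_nb [simp]: "y \<in> nb x S \<longleftrightarrow> y \<in> S \<and> adj x y"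
  by (simp add: nb_def)

lemma nb_subset: "nb x S \<subseteq> S"
  by auto

lemma finite_nb [simp]: "finite S \<Longrightarrow> finite (nb x S)"
  by (simp add: nb_def)

lemma dg_mono: "finite T \<Longrightarrow> S \<subseteq> T \<Longrightarrow> dg x S \<le> dg x T"
  unfolding dg_def by (intro card_mono) auto

lemma dg_Diff_list:
  assumes "finite S"
  shows "dg x S \<le> dg x (S - set zs) + length (filter (adj x) zs)"
proof -
  have "dg x S \<le> card (nb x (S - set zs) \<union> set (filter (adj x) zs))"
    unfolding dg_def using assms by (intro card_mono) auto
  also have "\<dots> \<le> dg x (S - set zs) + card (set (filter (adj x) zs))"
    unfolding dg_def by (rule card_Un_le)
  also have "\<dots> \<le> dg x (S - set zs) + length (filter (adj x) zs)"
    using card_length[of "filter (adj x) zs"] by simp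
  finally show ?thesis .
qed

lemma dg_remove_nonadj: "\<not> adj x y \<Longrightarrow> dg x (S - {y}) = dg x S"
  unfolding dg_def by (rule arg_cong[where f = card]) auto

lemma dg_remove_adj: "finite S \<Longrightarrow> y \<in> S \<Longrightarrow> adj x y \<Longrightarrow> dg x S = Suc (dg x (S - {y}))"
proof -
  assume "finite S" "y \<in> S" "adj x y"
  moreover from this have "nb x S = insert y (nb x (S - {y}))" by auto
  ultimately show ?thesis unfolding dg_def by simp
qed

lemma dg_remove_le: "finite S \<Longrightarrow> dg x S \<le> Suc (dg x (S - {y}))"
  using dg_Diff_list[of S x "[y]"] by (simp split: if_splits)

lemma is_path_rev [simp]: "is_path (rev xs) \<longleftrightarrow> is_path xs"
  by (simp add: is_path_def adj_commute)

text \<open>The number of missing vertices is even, so closing up through a common neighbour of the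
  ends leaves \<open>2 * h - 1\<close> of them, and half of this rounds up to
  \<open>h\<close>.\<close>

definition state :: "nat \<Rightarrow> 'a list \<Rightarrow> bool" where
  "state h P \<longleftrightarrow> is_path P \<and> P \<noteq> [] \<and> card (V - set P) = 2 * h \<and>
     h \<le> dg (hd P) (V - set P) \<and> h \<le> dg (last P) (V - set P) \<and>
     2 * h < dg (hd P) (V - set P) + dg (last P) (V - set P)"

lemma state_rev: "state h P \<Longrightarrow> state h (rev P)"
  by (auto simp: state_def hd_rev last_rev)

text \<open>The new ends \<open>a\<close> and \<open>b\<close> are read off lists that contain the
  old ends, so that extension at one side only is covered by an empty \<open>pre\<close> or
  \<open>suf\<close>.\<close>

lemma state_extend:
  assumes P: "is_path P" "P \<noteq> []"
    and zs: "zs = pre @ suf" "distinct zs" "set zs \<subseteq> V - set P"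
    and adj: "successively adj (pre @ [hd P])" "successively adj (last P # suf)"
    and card: "card (V - set P) = 2 * h + length zs"
    and ab: "a = hd (pre @ [hd P])" "b = last (last P # suf)"
    and deg: "h \<le> dg a (V - set P - set zs)" "h \<le> dg b (V - set P - set zs)"
      "2 * h < dg a (V - set P - set zs) + dg b (V - set P - set zs)"
  shows "state h (pre @ P @ suf)"
proof -
  have W: "V - set (pre @ P @ suf) = V - set P - set zs"
    using zs by auto
  have "card (V - set P - set zs) = card (V - set P) - card (set zs)"
    using zs by (intro card_Diff_subset) auto
  then have "card (V - set P - set zs) = 2 * h"
    using card zs distinct_card[of zs] by simp
  moreover have "is_path (pre @ P @ suf)"
    using P zs adj unfolding is_path_def
    by (auto simp: successively_append_iff successively_Cons)
  moreover have "hd (pre @ P @ suf) = a"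
    using P ab by (cases pre) auto
  moreover have "last (pre @ P @ suf) = b"
    using P ab by (cases suf) auto
  ultimately show ?thesis
    unfolding state_def W using P deg by auto
qed

end

text \<open>The negated claim in integers: for \<open>m\<close> remaining vertices, exceeding
  \<open>(m - 1) / 2\<close> means \<open>m \<le> 2 * d\<close> for the maximum degree
  \<open>d\<close>, and the witness \<open>x\<close> excludes \<open>m = 0\<close>.\<close>

locale counterexample = finite_graph +
  assumes counterexample: "closed_path c \<Longrightarrow>
    \<exists>x \<in> V - set c. card (V - set c) \<le> 2 * dg x (V - set c)"

section \<open>Descent from a path state with the fewest missing vertices\<close>

locale minimal_state = counterexample +
  fixes h :: nat and P :: "'a list"
  assumes minimal: "h' < h \<Longrightarrow> \<not> state h' P'"
    and path_P: "is_path P" and P_nonempty: "P \<noteq> []"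
    and card_outside: "card (V - set P) = 2 * h"
    and deg_hd: "Suc h \<le> dg (hd P) (V - set P)"
    and deg_last: "h \<le> dg (last P) (V - set P)"
begin

abbreviation u where "u \<equiv> hd P"
abbreviation v where "v \<equiv> last P"
abbreviation W where "W \<equiv> V - set P"

lemma finite_W [simp]: "finite W"
  using finite_V by simp

text \<open>Adding \<open>2 * k\<close> vertices lowers \<open>h\<close> by \<open>k\<close>, so an
  extension whose ends keep enough neighbours contradicts minimality.\<close>

lemma extend':
  assumes zs: "zs = pre @ suf" "distinct zs" "set zs \<subseteq> W" "length zs = 2 * k" "0 < k"
    and adj: "successively adj (pre @ [u])" "successively adj (v # suf)"
    and ab: "a = hd (pre @ [u])" "b = last (v # suf)"
    and deg: "h \<le> dg a (W - set zs) + k" "h \<le> dg b (W - set zs) + k"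
      "2 * h < dg a (W - set zs) + dg b (W - set zs) + 2 * k"
  shows False
proof -
  have "length zs \<le> 2 * h"
    using zs card_outside distinct_card[of zs] card_mono[of W "set zs"] by simp
  with zs have k: "k \<le> h" by simp
  have "state (h - k) (pre @ P @ suf)"
    by (rule state_extend[OF path_P P_nonempty zs(1-3) adj _ ab])
       (use card_outside zs(4,5) k deg in auto)
  moreover have "h - k < h" using k zs(5) by simp
  ultimately show False using minimal by blast
qed

lemma extend:
  assumes zs: "zs = pre @ suf" "distinct zs" "set zs \<subseteq> W" "length zs = 2 * k" "0 < k"
    and adj: "successively adj (pre @ [u])" "successively adj (v # suf)"
    and ab: "a = hd (pre @ [u])" "b = last (v # suf)"
    and deg: "h + length (filter (adj a) zs) \<le> dg a W + k" "h + length (filter (adj b) zs) \<le> dg b W + k"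
      "2 * h + length (filter (adj a) zs) + length (filter (adj b) zs) < dg a W + dg b W + 2 * k"
  shows False
  by (rule extend'[OF zs adj ab])
     (use deg dg_Diff_list[of W a zs] dg_Diff_list[of W b zs] in auto)

lemma closing_vertex_bad:
  assumes "y \<in> W" "adj u y" "adj v y"
  obtains t where "t \<in> W" "t \<noteq> y" "h \<le> dg t (W - {y})"
proof -
  have "closed_path (P @ [y])"
    using assms path_P P_nonempty
    by (auto simp: closed_path_def is_path_def successively_append_iff adj_commute)
  from counterexample[OF this] obtain t where
    t: "t \<in> V - set (P @ [y])" "card (V - set (P @ [y])) \<le> 2 * dg t (V - set (P @ [y]))" by blast
  have eq: "V - set (P @ [y]) = W - {y}" by auto
  have "card (W - {y}) = 2 * h - 1" using assms card_outside by simp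
  with t(2) have "h \<le> dg t (W - {y})" unfolding eq by simp
  with t show thesis by (intro that[of t]) auto
qed

text \<open>A common neighbour \<open>z\<close> of \<open>v\<close> and \<open>t\<close> would allow
  \<open>z, t\<close> to be appended. Without one, the neighbourhoods of \<open>v\<close> and
  \<open>t\<close> in \<open>W\<close> are disjoint, and their sizes make them complementary
  halves.\<close>

lemma high_outside_hd_nbs:
  assumes t: "t \<in> W" "\<not> adj u t" "h \<le> dg t W"
  shows "adj v t" "\<And>z. z \<in> W \<Longrightarrow> adj v z \<longleftrightarrow> \<not> adj t z" "dg v W = h" "dg t W = h"
proof -
  have no: False if z: "z \<in> W" "adj v z" "adj t z" for z
  proof (rule extend[of "[z, t]" "[]" "[z, t]" 1 u t])
    show "h + length (filter (adj u) [z, t]) \<le> dg u W + 1" "h + length (filter (adj t) [z, t]) \<le> dg t W + 1"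
      "2 * h + length (filter (adj u) [z, t]) + length (filter (adj t) [z, t]) < dg u W + dg t W + 2 * 1"
      using t deg_hd z by (auto simp: adj_commute)
  qed (use z t in \<open>auto simp: adj_commute\<close>)
  then have dj: "nb v W \<inter> nb t W = {}" by fastforce
  then have c: "card (nb v W \<union> nb t W) = dg v W + dg t W"
    by (simp add: dg_def card_Un_disjoint)
  moreover have "card (nb v W \<union> nb t W) \<le> card W" by (intro card_mono) auto
  ultimately show 1: "dg v W = h" "dg t W = h" using t deg_last card_outside by auto
  with c have "nb v W \<union> nb t W = W" using card_outside by (intro card_subset_eq) auto
  then show "\<And>z. z \<in> W \<Longrightarrow> adj v z \<longleftrightarrow> \<not> adj t z" using dj by auto
  with t show "adj v t" by simp
qed

text \<open>The bad vertex \<open>t\<close> of the cycle closed by \<open>y\<close> is adjacent to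
  an end of the path. If \<open>y\<close> had degree \<open>h\<close> too, \<open>t\<close> and
  \<open>y\<close> could be added at opposite ends.\<close>

lemma common_nb_low:
  assumes y: "y \<in> W" "adj u y" "adj v y"
  shows "dg y W < h"
proof (rule ccontr)
  assume "\<not> dg y W < h"
  then have hy: "h \<le> dg y W" by simp
  obtain t where t: "t \<in> W" "t \<noteq> y" "h \<le> dg t (W - {y})"
    using closing_vertex_bad y by blast
  have ht: "h + (if adj t y then 1 else 0) \<le> dg t W"
    using t y dg_remove_adj[of W y t] dg_remove_nonadj[of t y W] by auto
  show False
  proof (cases "adj u t")
    case True
    show False
      by (rule extend[of "[t, y]" "[t]" "[y]" 1 t y])
         (use t y hy ht True in \<open>auto simp: adj_commute split: if_splits\<close>)
  next
    case False
    then have "adj v t" using high_outside_hd_nbs(1) t(1) ht by auto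
    then show False
      by (intro extend[of "[y, t]" "[y]" "[t]" 1 y t])
         (use t y hy ht in \<open>auto simp: adj_commute split: if_splits\<close>)
  qed
qed


lemma no_nb_of_last_dominating:
  assumes t: "t \<in> W" "\<not> adj u t" "dg t W = h"
    and part: "\<And>z. z \<in> W \<Longrightarrow> adj v z \<longleftrightarrow> \<not> adj t z"
  shows False
proof -
  define A Y where "A = nb t W" and "Y = nb v W"
  have AY: "A \<union> Y = W" "A \<inter> Y = {}" using part by (auto simp: A_def Y_def)
  have fin: "finite A" "finite Y" by (simp_all add: A_def Y_def)
  have cA: "card A = h" using t(3) by (simp add: A_def dg_def)
  have "card W = card A + card Y" using AY fin card_Un_disjoint by metis
  then have cY: "card Y = h" using cA card_outside by simp
  have tY: "t \<in> Y" "t \<notin> A" using t part[of t] by (auto simp: A_def Y_def)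
  have False
    \<comment> \<open>\<open>L\<close> alternates between \<open>Y\<close> and \<open>A\<close>; prepending one vertex of each keeps its last vertex \<open>t\<close>, which dominates \<open>A\<close>.\<close>
    if "card (A - set L) = n" "distinct L" "set L \<subseteq> W" "L \<noteq> []" "last L = t"
      "successively adj (v # L)" "card (set L \<inter> Y) = Suc (card (set L \<inter> A))"
      "\<And>y. y \<in> set L \<inter> Y \<Longrightarrow> \<not> adj u y" "\<And>a. a \<in> A - set L \<Longrightarrow> a \<noteq> x0 \<Longrightarrow> adj (hd L) a"
    for n L x0
    using that
  proof (induction n arbitrary: L x0 rule: less_induct)
    case (less n L x0)
    note L = less.prems
    define j where "j = card (set L \<inter> A)"
    define AL YL where "AL = A - set L" and "YL = Y - set L"
    have R: "W - set L = AL \<union> YL" "AL \<inter> YL = {}" using AY by (auto simp: AL_def YL_def)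
    have finL: "finite AL" "finite YL" using fin by (auto simp: AL_def YL_def)
    have jA: "card AL + j = h"
    proof -
      have "card (set L \<inter> A) + card (A - set L) = card A"
        using fin by (metis Int_commute card_Int_Diff)
      then show ?thesis using cA by (simp add: j_def AL_def)
    qed
    have jY: "card YL + Suc j = h"
    proof -
      have "card (set L \<inter> Y) + card (Y - set L) = card Y"
        using fin by (metis Int_commute card_Int_Diff)
      then show ?thesis using cY L(7) by (simp add: j_def YL_def)
    qed
    have lenL: "length L = Suc (2 * j)"
    proof -
      have "length L = card (set L)" using L(2) distinct_card by metis
      also have "set L = (set L \<inter> Y) \<union> (set L \<inter> A)" using L(3) AY by auto
      also have "card \<dots> = card (set L \<inter> Y) + card (set L \<inter> A)"
        using AY fin by (intro card_Un_disjoint) auto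
      finally show ?thesis using L(7) by (simp add: j_def)
    qed
    have hu: "Suc h \<le> dg u (W - set L) + j"
    proof -
      have "length (filter (adj u) L) = card (set (filter (adj u) L))"
        using L(2) by (metis distinct_card distinct_filter)
      also have "\<dots> \<le> j" unfolding j_def using L(3,8) AY by (intro card_mono) auto
      finally show ?thesis using dg_Diff_list[of W u L] deg_hd by simp
    qed
    have split_dg: "dg a (W - set L) \<le> dg a AL + dg a YL" for a
    proof -
      have "nb a (W - set L) = nb a AL \<union> nb a YL" using R by auto
      then show ?thesis unfolding dg_def by (simp add: card_Un_le)
    qed
    have dg_le: "dg a S \<le> card S" if "finite S" for a S
      unfolding dg_def using that by (intro card_mono) auto
    \<comment> \<open>At most \<open>j\<close> neighbours of \<open>u\<close> lie on
      \<open>L\<close>, and \<open>YL\<close> has only \<open>h - j - 1\<close> vertices.\<close>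
    have "dg u AL \<ge> 2" using split_dg[of u] dg_le[of YL u] finL hu jY by linarith
    then have "nb u AL \<noteq> {}" by (auto simp: dg_def)
    then obtain x where x: "x \<in> AL" "adj u x" by auto
    have xt: "adj t x" using x by (auto simp: AL_def A_def)
    have xW: "x \<in> W" "x \<notin> set L" using x AY by (auto simp: AL_def)
    have LV: "set L \<subseteq> V" "set L \<inter> set P = {}" using L(3) by auto
    have adjL: "adj v (hd L)" "successively adj L"
      using L(4,6) by (cases L; simp)+
    have "closed_path (P @ L @ [x])"
      using path_P P_nonempty L LV xW xt x(2) adjL
      by (auto simp: closed_path_def is_path_def successively_append_iff adj_commute)
    from counterexample[OF this] obtain b where
      b: "b \<in> V - set (P @ L @ [x])" "card (V - set (P @ L @ [x])) \<le> 2 * dg b (V - set (P @ L @ [x]))"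
      by blast
    have eq: "V - set (P @ L @ [x]) = W - set L - {x}" by auto
    have "card (W - set L) = card AL + card YL"
      using R finL by (simp add: card_Un_disjoint)
    then have "card (W - set L - {x}) = card AL + card YL - 1"
      using xW by simp
    then have bd: "h \<le> dg b (W - set L - {x}) + Suc j" using b(2) jA jY unfolding eq by simp
    have bin: "b \<in> AL \<union> YL" "b \<noteq> x" "b \<in> W" "b \<notin> set L" using b(1) R unfolding eq by auto
    have bd': "dg b (W - set L - {x}) \<le> dg b (W - set L)" by (intro dg_mono) auto
    show False
    proof (cases "b \<in> AL")
      \<comment> \<open>A bad vertex in \<open>A\<close> is a neighbour of \<open>t\<close>, so the
        path can run on through \<open>L\<close> to \<open>b\<close>.\<close>
      case True
      then have tb: "adj t b" by (auto simp: AL_def A_def)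
      have eq2: "W - set (L @ [b]) = W - set L - {b}" by auto
      show False
      proof (rule extend'[of "L @ [b]" "[]" "L @ [b]" "Suc j" u b])
        show "successively adj (v # L @ [b])"
          using L tb by (auto simp: successively_append_iff successively_Cons)
        show "h \<le> dg b (W - set (L @ [b])) + Suc j"
          unfolding eq2 using bd bd' by (simp add: dg_remove_nonadj)
        show "h \<le> dg u (W - set (L @ [b])) + Suc j"
          unfolding eq2 using hu dg_remove_le[of "W - set L" u b] by simp
        show "2 * h < dg u (W - set (L @ [b])) + dg b (W - set (L @ [b])) + 2 * Suc j"
          unfolding eq2 using hu dg_remove_le[of "W - set L" u b] bd bd' by (simp add: dg_remove_nonadj)
      qed (use L bin lenL in auto)
    next
      case False
      then have bY: "b \<in> YL" using bin by auto
      then have bvY: "adj v b" "b \<in> Y" "\<not> adj t b" "b \<noteq> t"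
        using part[of b] tY L(4,5) by (auto simp: YL_def Y_def)
      have dgb: "dg b (W - set L - {x}) \<le> dg b (AL - {x}) + dg b (YL - {b})"
      proof -
        have "nb b (W - set L - {x}) \<subseteq> nb b (AL - {x}) \<union> nb b (YL - {b})" using R by auto
        then have "card (nb b (W - set L - {x})) \<le> card (nb b (AL - {x}) \<union> nb b (YL - {b}))"
          using finL by (intro card_mono) auto
        then show ?thesis unfolding dg_def using card_Un_le order_trans by blast
      qed
      have "dg b (YL - {b}) < card YL"
        using dg_le[of "YL - {b}" b] finL bY by (metis card_Diff1_less finite_Diff order_le_less_trans)
      then have "dg b (AL - {x}) > 0" using dgb bd jY by linarith
      then have "nb b (AL - {x}) \<noteq> {}" by (auto simp: dg_def)
      then obtain s where s: "s \<in> AL" "adj b s" by auto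
      have ts: "adj t s" "s \<in> W" "\<not> adj v s" using s part[of s] by (auto simp: AL_def A_def)
      \<comment> \<open>The detour \<open>v, p, b, s, t\<close> ends at \<open>t\<close>, which sees
        only \<open>s\<close> among the added vertices. So \<open>b\<close> has no neighbour in
        \<open>Y\<close>, and its degree forces it to see all of \<open>AL - {x}\<close>.\<close>
      have noY: False if p: "p \<in> W" "adj v p" "adj b p" for p
      proof (rule extend[of "[p, b, s, t]" "[]" "[p, b, s, t]" 2 u t])
        have tp: "\<not> adj t p" "p \<noteq> t" "p \<noteq> s" "p \<noteq> b"
          using part[of p] p ts bvY by (auto simp: adj_commute)
        show "distinct [p, b, s, t]" using tp bvY ts by auto
        have lt: "length (filter (adj t) [p, b, s, t]) = 1" using tp bvY ts by simp
        have lu: "length (filter (adj u) [p, b, s, t]) \<le> 3" using t by auto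
        show "h + length (filter (adj u) [p, b, s, t]) \<le> dg u W + 2" using lu deg_hd by linarith
        show "h + length (filter (adj t) [p, b, s, t]) \<le> dg t W + 2" using lt t by simp
        show "2 * h + length (filter (adj u) [p, b, s, t]) + length (filter (adj t) [p, b, s, t])
            < dg u W + dg t W + 2 * 2" using lt lu deg_hd t by linarith
      qed (use p bin ts t s in \<open>auto simp: adj_commute\<close>)
      then have "nb b (YL - {b}) = {}" by (fastforce simp: YL_def Y_def)
      then have "dg b (AL - {x}) \<ge> card (AL - {x})"
        using dgb bd jA x(1) finL by (simp add: dg_def)
      then have all: "nb b (AL - {x}) = AL - {x}"
        unfolding dg_def by (rule card_seteq[rotated 2]) (use finL in auto)
      have full: "adj b a" if "a \<in> AL" "a \<noteq> x" for a
      proof -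
        have "a \<in> nb b (AL - {x})" unfolding all using that by blast
        then show ?thesis by simp
      qed
      have nbt: "dg t (W - set (b # L)) = card AL"
        unfolding dg_def by (rule arg_cong[where f = card]) (use bvY in \<open>auto simp: AL_def A_def\<close>)
      have "\<not> adj u b"
      proof
        assume ub: "adj u b"
        have db: "dg b (W - set (b # L)) = dg b (W - set L)"
          unfolding dg_def by (rule arg_cong[where f = card]) auto
        show False
          by (rule extend'[of "b # L" "[b]" L "Suc j" b t])
             (use L bin lenL ub adjL nbt db bd bd' jA in \<open>auto simp: adj_commute\<close>)
      qed
      then have "dg u YL \<le> dg u (YL - {b})" by (simp add: dg_remove_nonadj)
      also have "\<dots> \<le> card YL - 1" using dg_le[of "YL - {b}" u] finL bY by simp
      finally have "dg u YL \<le> card YL - 1" .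
      moreover have "0 < card YL" using bY finL by (auto simp: card_gt_0_iff)
      ultimately have "3 \<le> card AL"
        using split_dg[of u] hu jY dg_le[of AL u] finL by linarith
      \<comment> \<open>The link \<open>x'\<close> has to avoid the old exception \<open>x0\<close>
        in order to see the head of \<open>L\<close>, and the new exception \<open>x\<close> in
        order to see \<open>b\<close>.\<close>
      then have "\<not> AL \<subseteq> {x, x0}"
        using card_mono[of "{x, x0}" AL] card_length[of "[x, x0]"] by auto
      then obtain x' where x': "x' \<in> AL" "x' \<noteq> x" "x' \<noteq> x0" by auto
      have x'': "adj b x'" "adj (hd L) x'" "x' \<in> W" "x' \<in> A" "x' \<notin> Y" "x' \<notin> set L" "x' \<noteq> b"
        using full x' L(9) AY bvY by (auto simp: AL_def)
      show False
      proof (rule less.IH[of "card (A - set (b # x' # L))" "b # x' # L" x])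
        have "A - set (b # x' # L) \<subset> A - set L" using x'' by auto
        then show "card (A - set (b # x' # L)) < n" using L(1) fin psubset_card_mono by blast
        show "successively adj (v # b # x' # L)"
          using bvY x'' adjL L(4) by (auto simp: successively_Cons adj_commute)
        have "set (b # x' # L) \<inter> Y = insert b (set L \<inter> Y)" "set (b # x' # L) \<inter> A = insert x' (set L \<inter> A)"
          using bvY x'' AY by auto
        then show "card (set (b # x' # L) \<inter> Y) = Suc (card (set (b # x' # L) \<inter> A))"
          using bin x'' L(7) by simp
        show "\<And>y. y \<in> set (b # x' # L) \<inter> Y \<Longrightarrow> \<not> adj u y"
          using L(8) \<open>\<not> adj u b\<close> x'' by auto
        show "\<And>a. a \<in> A - set (b # x' # L) \<Longrightarrow> a \<noteq> x \<Longrightarrow> adj (hd (b # x' # L)) a"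
          using full by (auto simp: AL_def)
      qed (use L bin x'' in auto)
    qed
  qed
  \<comment> \<open>Initially there is no exception: \<open>t\<close> sees all of \<open>A\<close>,
    and the value \<open>t\<close> for \<open>x0\<close> is a dummy outside
    \<open>A\<close>.\<close>
  from this[of "[t]" "card (A - {t})" t] show False
    using t tY part[of t] by (auto simp: A_def)
qed


text \<open>The bad vertices of the cycles closed by single vertices of \<open>J\<close> have
  exactly \<open>h\<close> neighbours in \<open>W\<close>, and two of them with different traces on
  \<open>J\<close> share no neighbour outside \<open>J\<close>. The counting lemma
  \<open>no_small_family_of_large_sets\<close> forbids such a family.\<close>

lemma impossible: False
proof -
  define J where "J = nb u W \<inter> nb v W"
  define T where "T = {t \<in> W. h \<le> dg t W \<and> (\<exists>y\<in>J. y \<noteq> t \<and> h \<le> dg t (W - {y}))}"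
  have "card W < card (nb u W) + card (nb v W)"
    using deg_hd deg_last card_outside by (simp add: dg_def)
  then have J: "J \<noteq> {}" unfolding J_def
    by (intro card_gt_imp_inter_nonempty[of W]) auto
  have T: "adj u t" "\<not> adj v t" "dg t W = h" "nb v W \<inter> nb t W \<noteq> {}" if tT: "t \<in> T" for t
  proof -
    from tT have t: "t \<in> W" "h \<le> dg t W" by (auto simp: T_def)
    show ut: "adj u t"
      using no_nb_of_last_dominating[OF t(1)] high_outside_hd_nbs[OF t(1) _ t(2)] by blast
    show vt: "\<not> adj v t" using common_nb_low[OF t(1) ut] t(2) by auto
    have "0 < card W" using t by (auto simp: card_gt_0_iff)
    then have "card (W - {t}) < card (nb v W) + card (nb t W)"
      using t deg_last card_outside by (simp add: dg_def)
    then show "nb v W \<inter> nb t W \<noteq> {}"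
      using vt by (intro card_gt_imp_inter_nonempty[of "W - {t}"]) auto
    then obtain z where "z \<in> nb v W \<inter> nb t W" by blast
    then have z: "z \<in> W" "adj v z" "adj t z" by auto
    show "dg t W = h"
    proof (rule ccontr)
      assume "dg t W \<noteq> h"
      then have "h < dg t W" using t by simp
      then show False
        by (intro extend[of "[z, t]" "[]" "[z, t]" 1 u t])
           (use z t deg_hd in \<open>auto simp: adj_commute\<close>)
    qed
  qed
  have miss: "\<exists>t\<in>T. \<not> adj t y" if y: "y \<in> J" for y
  proof -
    obtain t where t: "t \<in> W" "t \<noteq> y" "h \<le> dg t (W - {y})"
      using closing_vertex_bad[of y] y by (auto simp: J_def)
    moreover have "dg t (W - {y}) \<le> dg t W" by (intro dg_mono) auto
    ultimately have tT: "t \<in> T" using y by (auto simp: T_def)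
    moreover have "\<not> adj t y"
      using dg_remove_adj[of W y t] t T(3)[OF tT] y by (auto simp: J_def)
    ultimately show ?thesis by blast
  qed
  \<comment> \<open>Otherwise \<open>z\<close> and \<open>t\<close> can be attached at the end that
    sees \<open>z\<close>; the opposite end does not see \<open>z\<close> and keeps enough
    neighbours.\<close>
  have same: "adj u z \<longleftrightarrow> adj v z" if t: "t \<in> T" and z: "z \<in> W" "adj t z" for t z
  proof -
    have tW: "t \<in> W" "t \<noteq> z" using t z by (auto simp: T_def)
    have False if "adj v z" "\<not> adj u z"
      by (rule extend[of "[z, t]" "[]" "[z, t]" 1 u t])
         (use that z tW deg_hd T(1-3)[OF t] in \<open>auto simp: adj_commute\<close>)
    moreover have False if "adj u z" "\<not> adj v z"
      by (rule extend[of "[t, z]" "[t, z]" "[]" 1 t v])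
         (use that z tW deg_last T(1-3)[OF t] in \<open>auto simp: adj_commute\<close>)
    ultimately show ?thesis by blast
  qed
  have TT: "\<not> adj t t'" if "t \<in> T" "t' \<in> T" for t t'
    using same[of t t'] T[OF that(2)] that by (auto simp: T_def)
  have deg_v: "dg v W = h"
  proof (rule ccontr)
    assume "dg v W \<noteq> h"
    then have hv: "h < dg v W" using deg_last by simp
    obtain t where t: "t \<in> T" using J miss by blast
    then obtain z where "z \<in> nb v W \<inter> nb t W" using T(4) by blast
    then have z: "z \<in> W" "adj v z" "adj t z" by auto
    then have "adj u z" using same t by blast
    then show False
      by (intro extend[of "[t, z]" "[t, z]" "[]" 1 t v])
         (use hv z t T(1-3)[OF t] in \<open>auto simp: adj_commute T_def\<close>)
  qed
  \<comment> \<open>The path is prolonged at \<open>v\<close> by \<open>y, t, z, t'\<close>. Among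
    these, \<open>u\<close> does not see \<open>z\<close> and \<open>t'\<close> sees only
    \<open>z\<close>, which is just enough.\<close>
  have inter: "nb t W \<inter> nb t' W \<subseteq> J"
    if t: "t \<in> T" "t' \<in> T" and y: "y \<in> J" "adj t y" "\<not> adj t' y" for t t' y
  proof (rule ccontr)
    assume "\<not> ?thesis"
    then obtain z where "z \<in> nb t W \<inter> nb t' W" "z \<notin> J" by blast
    then have z: "z \<in> W" "adj t z" "adj t' z" "z \<notin> J" by auto
    then have uz: "\<not> adj u z" "\<not> adj v z" using same[OF t(1)] by (auto simp: J_def)
    have y': "y \<in> W" "adj u y" "adj v y" using y by (auto simp: J_def)
    have ne: "t \<in> W" "t' \<in> W" "t \<noteq> t'" "y \<noteq> z" "y \<noteq> t" "y \<noteq> t'" "z \<noteq> t" "z \<noteq> t'"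
      using t y y' z uz T(2) by (auto simp: T_def)
    show False
      by (rule extend[of "[y, t, z, t']" "[]" "[y, t, z, t']" 2 u t'])
         (use ne z uz y y' T(1-3)[OF t(1)] T(1-3)[OF t(2)] TT[OF t] deg_hd in
            \<open>auto simp: adj_commute\<close>)
  qed
  show False
  proof (rule no_small_family_of_large_sets[of W h J T "\<lambda>t. nb t W"])
    show "card J \<le> h" unfolding deg_v[symmetric] dg_def J_def by (intro card_mono) auto
    show "T \<inter> J = {}" using T(2) by (auto simp: J_def)
    show "nb t W \<subseteq> W - T" if "t \<in> T" for t using TT that by auto
    show "card (nb t W) = h" if "t \<in> T" for t using T(3)[OF that] by (simp add: dg_def)
    show "nb t W \<inter> J \<noteq> {}" if t: "t \<in> T" for t
    proof -
      obtain z where "z \<in> nb v W \<inter> nb t W" using T(4)[OF t] by blast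
      then have "z \<in> nb t W \<inter> J" using same[OF t] by (auto simp: J_def)
      then show ?thesis by blast
    qed
    show "\<exists>t\<in>T. y \<notin> nb t W" if "y \<in> J" for y using miss[OF that] by auto
    show "nb t W \<inter> nb t' W \<subseteq> J" if "t \<in> T" "t' \<in> T" "nb t W \<inter> J \<noteq> nb t' W \<inter> J" for t t'
    proof -
      from that(3) obtain y where y: "y \<in> J" "y \<in> nb t W \<longleftrightarrow> y \<notin> nb t' W" by blast
      then have "adj t y \<noteq> adj t' y" by (auto simp: J_def)
      with y show ?thesis using inter[of t t' y] inter[of t' t y] that by blast
    qed
  qed (use J card_outside in \<open>auto simp: J_def T_def\<close>)
qed

end

context counterexample
begin

text \<open>Strong induction on \<open>h\<close> makes the state at hand minimal. One end has more
  than \<open>h\<close> neighbours outside, and reversal makes it the head.\<close>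

lemma no_state: "\<not> state h P"
proof (induction h arbitrary: P rule: less_induct)
  case (less h)
  have *: False if st: "state h P" "Suc h \<le> dg (hd P) (V - set P)" for P
  proof -
    interpret minimal_state V adj h P
      by unfold_locales (use st less.IH in \<open>auto simp: state_def\<close>)
    show False by (rule impossible)
  qed
  show ?case
  proof
    assume st: "state h P"
    then have "Suc h \<le> dg (hd P) (V - set P) \<or> Suc h \<le> dg (last P) (V - set P)"
      by (auto simp: state_def)
    then show False
      using *[OF st] *[OF state_rev[OF st]] st by (auto simp: state_def hd_rev)
  qed
qed

section \<open>Graphs of even order\<close>

lemma no_extension:
  assumes P: "is_path P" "P \<noteq> []"
    and zs: "zs = pre @ suf" "distinct zs" "set zs \<subseteq> V - set P"
    and adj: "successively adj (pre @ [hd P])" "successively adj (last P # suf)"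
    and card: "card (V - set P) = 2 * h + length zs"
    and ab: "a = hd (pre @ [hd P])" "b = last (last P # suf)"
    and deg: "h + length (filter (adj a) zs) \<le> dg a (V - set P)"
      "h + length (filter (adj b) zs) \<le> dg b (V - set P)"
      "2 * h + length (filter (adj a) zs) + length (filter (adj b) zs) < dg a (V - set P) + dg b (V - set P)"
  shows False
proof -
  have "state h (pre @ P @ suf)"
    by (rule state_extend[OF P zs adj card ab])
       (use deg finite_V dg_Diff_list[of "V - set P" a zs] dg_Diff_list[of "V - set P" b zs] in auto)
  then show False using no_state by blast
qed

lemma no_even_path:
  assumes P: "is_path P" "P \<noteq> []" and card: "card V = 2 * h + length P"
    and deg: "h + length (filter (adj (hd P)) P) \<le> dg (hd P) V"
      "h + length (filter (adj (last P)) P) \<le> dg (last P) V"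
      "2 * h + length (filter (adj (hd P)) P) + length (filter (adj (last P)) P) < dg (hd P) V + dg (last P) V"
  shows False
proof -
  have "card (V - set P) = card V - card (set P)"
    using P by (intro card_Diff_subset) (auto simp: is_path_def)
  moreover have "card (set P) = length P" using P by (simp add: is_path_def distinct_card)
  ultimately have "state h P"
    unfolding state_def using assms finite_V dg_Diff_list[of V "hd P" P] dg_Diff_list[of V "last P" P] by auto
  then show False using no_state by blast
qed

lemma bad_vertex:
  assumes "closed_path c"
  obtains x where "x \<in> V" "x \<notin> set c" "card (V - set c) \<le> 2 * dg x (V - set c)"
  using counterexample[OF assms] by blast

lemma dg_le_card_superset: "finite T \<Longrightarrow> nb x S \<subseteq> T \<Longrightarrow> dg x S \<le> card T"
  unfolding dg_def by (rule card_mono)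

text \<open>The number of missing vertices is odd, so the path is not itself a state. A bad vertex
  \<open>t\<close> of the cycle through a common neighbour of the ends either prolongs the chain to
  a smaller instance or splits \<open>W - {t}\<close> into two halves without edges between them;
  then \<open>z\<close> can be exchanged so that a cycle without a bad vertex arises.\<close>

lemma no_odd_chain:
  assumes "is_path (p # z # Q)" "Q \<noteq> []" "W = V - set (p # z # Q)" "card W = 2 * h + 1"
    and "h + 2 \<le> dg p W" "h + 1 \<le> dg (hd Q) W" "h \<le> dg (last Q) W"
    and "\<And>x y. x \<in> nb p W \<Longrightarrow> y \<in> nb (hd Q) W \<Longrightarrow> \<not> adj x y"
  shows False
  using assms
proof (induction h arbitrary: Q W)
  case 0
  have "dg p W \<le> card W" using 0(3) finite_V by (intro dg_le_card_superset) auto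
  then show ?case using 0(4,5) by simp
next
  case (Suc g)
  define h where "h = Suc g"
  define a q where "a = last Q" and "q = hd Q"
  note prems = Suc.prems[folded h_def a_def q_def]
  have P: "is_path (p # z # Q)" "p # z # Q \<noteq> []" "hd (p # z # Q) = p" "last (p # z # Q) = a"
    using prems(1,2) by (auto simp: a_def)
  have fin [simp]: "finite W" using prems(3) finite_V by simp
  have W: "W = V - set (p # z # Q)" by (fact prems(3))
  have "card W < card (nb p W) + card (nb a W)" using prems(4,5,7) by (simp add: dg_def)
  then have "nb p W \<inter> nb a W \<noteq> {}" by (intro card_gt_imp_inter_nonempty[of W]) auto
  then obtain x where x: "x \<in> W" "adj p x" "adj a x" by auto
  have "closed_path ((p # z # Q) @ [x])"
    using P x W prems(2) by (auto simp: closed_path_def is_path_def successively_append_iff successively_Cons a_def adj_commute)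
  then obtain t where t: "t \<in> V" "t \<notin> set ((p # z # Q) @ [x])"
    and t2: "card (V - set ((p # z # Q) @ [x])) \<le> 2 * dg t (V - set ((p # z # Q) @ [x]))"
    by (rule bad_vertex)
  have eq: "V - set ((p # z # Q) @ [x]) = W - {x}" using W by auto
  have tW: "t \<in> W" using t W by auto
  have "dg t (W - {x}) \<le> dg t W" by (intro dg_mono) auto
  moreover have "h \<le> dg t (W - {x})" using t2 x prems(4) unfolding eq by simp
  ultimately have ht: "h \<le> dg t W" by simp
  \<comment> \<open>If \<open>t\<close> were adjacent to \<open>q\<close>, its neighbours would
    avoid the \<open>h + 2\<close> neighbours of \<open>p\<close>; if to \<open>p\<close>, they
    would avoid the \<open>h + 1\<close> neighbours of \<open>q\<close> and \<open>t\<close> itself.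
    Either way fewer than \<open>h\<close> of the \<open>2 * h + 1\<close> vertices remain.\<close>
  have qt: "\<not> adj q t"
  proof
    assume "adj q t"
    then have "dg t W \<le> card (W - nb p W)"
      using prems(8)[of _ t] tW by (intro dg_le_card_superset) (auto simp: adj_commute)
    also have "\<dots> = card W - dg p W" unfolding dg_def by (intro card_Diff_subset) auto
    finally show False using ht prems(4,5) by (simp add: h_def)
  qed
  have pt: "\<not> adj p t"
  proof
    assume "adj p t"
    then have "dg t W \<le> card (W - insert t (nb q W))"
      using prems(8)[of t] tW by (intro dg_le_card_superset) auto
    also have "\<dots> = card W - card (insert t (nb q W))" using tW by (intro card_Diff_subset) auto
    also have "card (insert t (nb q W)) = Suc (dg q W)" using qt by (simp add: dg_def)
    finally show False using ht prems(4,6) by (simp add: h_def)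
  qed
  \<comment> \<open>Appending \<open>t\<close> alone makes the number of missing vertices even, so
    the result would be a state.\<close>
  have at: "\<not> adj a t"
  proof
    assume "adj a t"
    then show False
      by (intro no_extension[OF P(1,2), of "[t]" "[]" "[t]" h p t, unfolded P(3,4)])
         (use tW pt ht prems(4,5) W in \<open>auto simp: adj_commute\<close>)
  qed
  \<comment> \<open>The chain grows by \<open>y, t\<close> while \<open>h\<close> drops by one;
    neither \<open>p\<close> nor \<open>q\<close> sees \<open>t\<close>, so each loses at most the
    neighbour \<open>y\<close>.\<close>
  have disj: False if y: "y \<in> W" "adj a y" "adj t y" for y
  proof (rule Suc.IH[of "Q @ [y, t]" "W - set [y, t]"])
    have yt: "y \<noteq> t" using y by auto
    show "is_path (p # z # Q @ [y, t])"
      using P(1) y tW yt W prems(2)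
      by (auto simp: is_path_def successively_append_iff successively_Cons a_def adj_commute)
    show "card (W - set [y, t]) = 2 * g + 1"
      using y tW yt prems(4) by (subst card_Diff_subset) (auto simp: h_def)
    show "g + 2 \<le> dg p (W - set [y, t])"
      using dg_Diff_list[of W p "[y, t]"] pt prems(5) by (auto simp: h_def split: if_splits)
    show "g + 1 \<le> dg (hd (Q @ [y, t])) (W - set [y, t])"
      using dg_Diff_list[of W q "[y, t]"] qt prems(2,6) by (auto simp: h_def q_def split: if_splits)
    show "g \<le> dg (last (Q @ [y, t])) (W - set [y, t])"
      using dg_Diff_list[of W t "[y, t]"] ht by (auto simp: h_def split: if_splits)
    show "\<not> adj x1 y1" if "x1 \<in> nb p (W - set [y, t])" "y1 \<in> nb (hd (Q @ [y, t])) (W - set [y, t])" for x1 y1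
      using prems(8)[of x1 y1] that prems(2) by (auto simp: q_def)
  qed (use W in auto)
  define A B where "A = nb t W" and "B = nb a W"
  have AB: "A \<inter> B = {}" "A \<subseteq> W - {t}" "B \<subseteq> W - {t}"
    using disj at by (auto simp: A_def B_def)
  have finAB [simp]: "finite A" "finite B" by (auto simp: A_def B_def)
  have "card (A \<union> B) = card A + card B" using AB by (simp add: card_Un_disjoint)
  moreover have "card (A \<union> B) \<le> card (W - {t})" using AB by (intro card_mono) auto
  moreover have "card (W - {t}) = 2 * h" using tW prems(4) by simp
  moreover have "h \<le> card A" "h \<le> card B" using ht prems(7) by (simp_all add: A_def B_def dg_def)
  ultimately have cAB: "card A = h" "card B = h" "card (A \<union> B) = card (W - {t})" by auto
  then have "A \<union> B = W - {t}" using AB by (intro card_subset_eq) auto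
  then have W_split: "W = insert t (A \<union> B)" using tW by auto
  \<comment> \<open>Such an edge would allow the extension \<open>b, c, t\<close>, whose odd length
    again yields a state.\<close>
  have no_edge: "\<not> adj b c" if bc: "b \<in> B" "c \<in> A" for b c
  proof
    assume "adj b c"
    note e = bc this
    show False
    proof (rule no_extension[OF P(1,2), of "[b, c, t]" "[]" "[b, c, t]" "h - 1" p t, unfolded P(3,4)])
      have bt: "\<not> adj t b" "adj t c" "b \<noteq> t" "c \<noteq> t" "b \<noteq> c" using e AB by (auto simp: A_def B_def)
      show "distinct [b, c, t]" using bt by auto
      have l: "length (filter (adj t) [b, c, t]) = 1" "length (filter (adj p) [b, c, t]) \<le> 2"
        using bt pt by auto
      show "h - 1 + length (filter (adj p) [b, c, t]) \<le> dg p (V - set (p # z # Q))"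
        "h - 1 + length (filter (adj t) [b, c, t]) \<le> dg t (V - set (p # z # Q))"
        "2 * (h - 1) + length (filter (adj p) [b, c, t]) + length (filter (adj t) [b, c, t])
          < dg p (V - set (p # z # Q)) + dg t (V - set (p # z # Q))"
        using l ht prems(5) unfolding W[symmetric] by (auto simp: h_def)
      show "card (V - set (p # z # Q)) = 2 * (h - 1) + length [b, c, t]"
        using prems(4) unfolding W by (simp add: h_def)
      show "set [b, c, t] \<subseteq> V - set (p # z # Q)" using e tW AB unfolding W[symmetric] by auto
    qed (use e in \<open>auto simp: A_def B_def adj_commute\<close>)
  qed
  have card_pA: "2 \<le> card (nb p W \<inter> A)"
  proof -
    have "nb p W \<subseteq> W - {t}" using pt by auto
    from card_inter_lower_bound[OF _ this AB(2)] show ?thesis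
      using cAB prems(5) \<open>card (W - {t}) = 2 * h\<close> by (simp add: dg_def)
  qed
  have "1 \<le> card (nb q W \<inter> A)"
  proof -
    have "nb q W \<subseteq> W - {t}" using qt by auto
    from card_inter_lower_bound[OF _ this AB(2)] show ?thesis
      using cAB prems(6) \<open>card (W - {t}) = 2 * h\<close> by (simp add: dg_def)
  qed
  then have "nb q W \<inter> A \<noteq> {}" by (metis card.empty not_one_le_zero)
  then obtain y1 where y1: "y1 \<in> A" "adj q y1" by auto
  have "\<not> nb p W \<inter> A \<subseteq> {y1}" using card_pA card_mono[of "{y1}" "nb p W \<inter> A"] by auto
  then obtain x1 where "x1 \<in> nb p W" "x1 \<in> A" "x1 \<noteq> y1" by blast
  then have x1: "x1 \<in> A" "adj p x1" "x1 \<noteq> y1" by auto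
  have x1y1: "adj t x1" "adj t y1" "x1 \<noteq> t" "y1 \<noteq> t" "x1 \<notin> B" "y1 \<notin> B" "x1 \<in> W" "y1 \<in> W"
    using x1 y1 AB by (auto simp: A_def)
  have "card {x1, y1} \<le> card A" using x1 y1 by (intro card_mono) auto
  then have h2: "2 \<le> h" using x1 cAB by simp
  \<comment> \<open>Now \<open>A\<close> and \<open>B\<close> are separated; replacing the link \<open>z\<close> by \<open>x1, t, y1\<close> balances them,
    and \<open>z\<close> itself is either reused to close the cycle or attached to \<open>A\<close> only.\<close>
  define A' where "A' = A - {x1, y1}"
  have cA': "card A' = h - 2" using x1 y1 cAB unfolding A'_def by (subst card_Diff_subset) auto
  have pzQ: "p \<notin> W" "z \<notin> W" "set Q \<inter> W = {}" "p \<in> V" "z \<in> V" "set Q \<subseteq> V" "p \<noteq> z" "p \<notin> set Q"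
    "z \<notin> set Q" "distinct Q" "adj p z" "successively adj Q"
    using P(1) W prems(2) by (auto simp: is_path_def successively_Cons)
  have path_pre: "is_path ([p, x1, t, y1] @ Q)"
    using pzQ x1 y1 x1y1 tW prems(2) W
    by (auto simp: is_path_def successively_append_iff successively_Cons q_def adj_commute)
  have nb_A': "nb r S \<subseteq> (A' - {r}) \<union> (S - W)" if "r \<in> A'" "S \<subseteq> V - {x1, t, y1}" for r S
  proof
    fix w assume "w \<in> nb r S"
    then have w: "w \<in> S" "adj r w" "w \<noteq> r" by auto
    moreover have "w \<notin> B" using no_edge[of w r] that(1) adj_sym[OF w(2)] by (auto simp: A'_def)
    ultimately show "w \<in> (A' - {r}) \<union> (S - W)" using that W_split by (auto simp: A'_def)
  qed
  have nb_B: "nb r S \<subseteq> (B - {r}) \<inter> S \<union> (nb r S - W)" if "r \<in> B" "t \<notin> S" for r S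
  proof
    fix w assume w: "w \<in> nb r S"
    then have "w \<notin> A" using no_edge[of r w] that(1) by auto
    then show "w \<in> (B - {r}) \<inter> S \<union> (nb r S - W)" using w that W_split by auto
  qed
  show False
  proof (cases "\<exists>b\<in>B. adj z b")
    \<comment> \<open>The cycle leaves parts of sizes \<open>h - 2\<close> and \<open>h - 1\<close>
      with no edges between them. A bad vertex needs \<open>h - 1\<close> neighbours, more than its
      own part can offer.\<close>
    case True
    then obtain b where b: "b \<in> B" "adj z b" by auto
    then have bW: "b \<in> W" "adj a b" "b \<noteq> x1" "b \<noteq> y1" "b \<noteq> t" using AB x1y1 by (auto simp: B_def)
    have "closed_path ([p, x1, t, y1] @ Q @ [b, z])"
      using path_pre bW b pzQ prems(2) W x1 x1y1 tW
      by (auto simp: closed_path_def is_path_def successively_append_iff successively_Cons a_def adj_commute)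
    then obtain r where r: "r \<in> V" "r \<notin> set ([p, x1, t, y1] @ Q @ [b, z])"
      "card (V - set ([p, x1, t, y1] @ Q @ [b, z])) \<le> 2 * dg r (V - set ([p, x1, t, y1] @ Q @ [b, z]))"
      by (rule bad_vertex)
    have rem: "V - set ([p, x1, t, y1] @ Q @ [b, z]) = A' \<union> (B - {b})"
      using W W_split x1y1 bW b AB unfolding A'_def by auto
    have "card (A' \<union> (B - {b})) = card A' + card (B - {b})"
      using AB by (intro card_Un_disjoint) (auto simp: A'_def)
    also have "\<dots> = 2 * h - 3" using cA' cAB b h2 by simp
    finally have dr: "h - 1 \<le> dg r (A' \<union> (B - {b}))" using r(3) unfolding rem by simp
    have S: "A' \<union> (B - {b}) - W = {}" "A' \<union> (B - {b}) \<subseteq> V - {x1, t, y1}" "t \<notin> A' \<union> (B - {b})"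
      using W_split W x1y1 AB by (auto simp: A'_def)
    have "r \<in> A' \<union> (B - {b})" using r(1,2) unfolding rem[symmetric] by blast
    then consider "r \<in> A'" | "r \<in> B" "r \<noteq> b" by blast
    then show False
    proof cases
      case 1
      have "dg r (A' \<union> (B - {b})) \<le> card (A' - {r})"
        using nb_A'[OF 1 S(2)] unfolding S(1) by (intro dg_le_card_superset) (simp_all add: A'_def)
      then show False using dr cA' h2 card_Diff1_le[of A' r] by linarith
    next
      case 2
      have "dg r (A' \<union> (B - {b})) \<le> card (B - {r, b})"
      proof (intro dg_le_card_superset)
        have "b \<notin> A' \<union> (B - {b})" using AB b by (auto simp: A'_def)
        show "nb r (A' \<union> (B - {b})) \<subseteq> B - {r, b}"
        proof
          fix w assume w: "w \<in> nb r (A' \<union> (B - {b}))"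
          then have "w \<in> A' \<union> (B - {b})" by simp
          with S(1) \<open>b \<notin> _\<close> have "w \<in> W" "w \<noteq> b" by auto
          moreover have "w \<in> (B - {r}) \<inter> (A' \<union> (B - {b})) \<union> (nb r (A' \<union> (B - {b})) - W)"
            using nb_B[OF 2(1) S(3)] w by (rule subsetD)
          ultimately show "w \<in> B - {r, b}" by simp
        qed
      qed simp
      also have "\<dots> = h - 2" using 2 b cAB by (subst card_Diff_subset) auto
      finally show False using dr h2 by simp
    qed
  next
    \<comment> \<open>Now \<open>z\<close> stays off the cycle and joins the smaller part. Both
      parts have \<open>h - 1\<close> vertices, while a bad vertex again needs \<open>h - 1\<close>
      neighbours.\<close>
    case False
    then have zB: "\<not> adj z b" if "b \<in> B" for b using that by auto
    have "card W < card (nb p W) + card (insert t B)"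
      using prems(4,5) cAB AB by (simp add: dg_def subset_Diff_insert)
    then have "nb p W \<inter> insert t B \<noteq> {}"
      using AB tW by (intro card_gt_imp_inter_nonempty[of W]) auto
    then obtain w where w: "w \<in> B" "adj p w" using pt by auto
    then have wW: "w \<in> W" "adj a w" "w \<noteq> x1" "w \<noteq> y1" "w \<noteq> t" using AB x1y1 by (auto simp: B_def)
    have "closed_path ([p, x1, t, y1] @ Q @ [w])"
      using path_pre wW w pzQ prems(2) W x1 x1y1 tW
      by (auto simp: closed_path_def is_path_def successively_append_iff successively_Cons a_def adj_commute)
    then obtain r where r: "r \<in> V" "r \<notin> set ([p, x1, t, y1] @ Q @ [w])"
      "card (V - set ([p, x1, t, y1] @ Q @ [w])) \<le> 2 * dg r (V - set ([p, x1, t, y1] @ Q @ [w]))"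
      by (rule bad_vertex)
    have rem: "V - set ([p, x1, t, y1] @ Q @ [w]) = insert z (A' \<union> (B - {w}))"
      using W W_split x1y1 wW w AB pzQ unfolding A'_def by auto
    have zin: "z \<notin> A' \<union> (B - {w})" using pzQ W_split by (auto simp: A'_def)
    have "card (A' \<union> (B - {w})) = card A' + card (B - {w})"
      using AB by (intro card_Un_disjoint) (auto simp: A'_def)
    also have "\<dots> = 2 * h - 3" using cA' cAB w h2 by simp
    finally have "card (insert z (A' \<union> (B - {w}))) = 2 * h - 2"
      using zin h2 by (subst card_insert_disjoint) (auto simp: A'_def)
    then have dr: "h - 1 \<le> dg r (insert z (A' \<union> (B - {w})))" using r(3) unfolding rem by simp
    have S: "insert z (A' \<union> (B - {w})) - W = {z}" "insert z (A' \<union> (B - {w})) \<subseteq> V - {x1, t, y1}"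
      "t \<notin> insert z (A' \<union> (B - {w}))"
      using W_split W x1y1 AB pzQ tW by (auto simp: A'_def)
    have "r \<in> insert z (A' \<union> (B - {w}))" using r(1,2) unfolding rem[symmetric] by blast
    then consider "r \<in> A'" | "r \<in> B" "r \<noteq> w" | "r = z" by blast
    then show False
    proof cases
      case 1
      have "dg r (insert z (A' \<union> (B - {w}))) \<le> card (insert z (A' - {r}))"
        using nb_A'[OF 1 S(2)] unfolding S(1) by (intro dg_le_card_superset) (simp_all add: A'_def)
      also have "\<dots> = Suc (card (A' - {r}))" using zin by (subst card_insert_disjoint) (auto simp: A'_def)
      also have "\<dots> = card A'" using 1 by (intro card_Suc_Diff1) (auto simp: A'_def)
      finally show False using dr cA' h2 by linarith
    next
      case 2
      have "dg r (insert z (A' \<union> (B - {w}))) \<le> card (B - {r, w})"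
      proof (intro dg_le_card_superset)
        have "w \<notin> insert z (A' \<union> (B - {w}))" using AB w zin wW pzQ by (auto simp: A'_def)
        show "nb r (insert z (A' \<union> (B - {w}))) \<subseteq> B - {r, w}"
        proof
          fix y assume y: "y \<in> nb r (insert z (A' \<union> (B - {w})))"
          then have "y \<in> insert z (A' \<union> (B - {w}))" "adj r y" by simp_all
          moreover have "\<not> adj r z" using zB[OF 2(1)] adj_commute by blast
          ultimately have "y \<noteq> z" "y \<noteq> w" "y \<in> insert z (A' \<union> (B - {w}))" using \<open>w \<notin> _\<close> by metis+
          moreover from this have "y \<in> W" using S(1) by blast
          moreover have "y \<in> (B - {r}) \<inter> insert z (A' \<union> (B - {w})) \<union> (nb r (insert z (A' \<union> (B - {w}))) - W)"
            using nb_B[OF 2(1) S(3)] y by (rule subsetD)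
          ultimately show "y \<in> B - {r, w}" by simp
        qed
      qed simp
      also have "\<dots> = h - 2" using 2 w cAB by (subst card_Diff_subset) auto
      finally show False using dr h2 by simp
    next
      case 3
      have "dg r (insert z (A' \<union> (B - {w}))) \<le> card A'"
        using zB 3 by (intro dg_le_card_superset) (auto simp: A'_def)
      then show False using dr cA' h2 by simp
    qed
  qed
qed


text \<open>In order \<open>2 * k + 1\<close>, a bad vertex of the empty cycle has degree at least
  \<open>k + 1\<close> and is a state on its own.\<close>

lemma even_card: "even (card V)"
proof (rule ccontr)
  assume "odd (card V)"
  then obtain k where k: "card V = 2 * k + 1" by (rule oddE)
  have "closed_path []" by (simp add: closed_path_def is_path_def)
  from counterexample[OF this] obtain u where u: "u \<in> V" "card V \<le> 2 * dg u V" by auto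
  show False
    by (rule no_even_path[of "[u]" k]) (use u k in \<open>auto simp: is_path_def\<close>)
qed

end

section \<open>Bounding the maximum degree by half of an even order\<close>

locale even_counterexample = counterexample +
  fixes k :: nat
  assumes card_V: "card V = 2 * k"
begin

text \<open>For ends of degree \<open>k\<close> the degree conditions only say that each end has at
  most \<open>j\<close> neighbours on the path and both together fewer than
  \<open>2 * j\<close>.\<close>

lemma no_path:
  assumes P: "is_path P" "P \<noteq> []" "length P = 2 * j"
    and deg: "k + length (filter (adj (hd P)) P) \<le> dg (hd P) V + j"
      "k + length (filter (adj (last P)) P) \<le> dg (last P) V + j"
      "2 * k + length (filter (adj (hd P)) P) + length (filter (adj (last P)) P) < dg (hd P) V + dg (last P) V + 2 * j"
  shows False
proof -
  have "length P \<le> card V"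
    using P(1) finite_V by (metis card_mono distinct_card is_path_def)
  then have "j \<le> k" using P card_V by simp
  then show False
    by (intro no_even_path[OF P(1,2), of "k - j"]) (use P card_V deg in auto)
qed

lemma k_pos: "0 < k"
proof -
  have "closed_path []" by (simp add: closed_path_def is_path_def)
  then obtain u where "u \<in> V" using bad_vertex by blast
  then have "card V \<noteq> 0" using finite_V by auto
  then show ?thesis using card_V by simp
qed

lemma common_nb:
  assumes "a \<in> V" "b \<in> V" "a \<noteq> b" "\<not> adj a b" "2 * k \<le> Suc (dg a V + dg b V)"
  obtains y where "y \<in> V" "adj a y" "adj b y"
proof -
  have "card (V - {a, b}) = 2 * k - 2" using assms card_V by (subst card_Diff_subset) auto
  then have "card (V - {a, b}) < card (nb a V) + card (nb b V)"
    using assms k_pos by (simp add: dg_def)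
  then have "nb a V \<inter> nb b V \<noteq> {}"
    using assms finite_V by (intro card_gt_imp_inter_nonempty[of "V - {a, b}"]) (auto simp: adj_commute)
  then show thesis using that by auto
qed

text \<open>If \<open>u\<close> has larger degree, the bad vertex \<open>v\<close> of the cycle
  \<open>u\<close> is not adjacent to \<open>u\<close>. With a common neighbour \<open>z\<close>,
  the path \<open>u, z, v\<close> falls under \<open>no_odd_chain\<close>, as an edge between
  neighbours of \<open>u\<close> and \<open>v\<close> would give a forbidden path on four
  vertices.\<close>

lemma degree_le: "x \<in> V \<Longrightarrow> dg x V \<le> k"
proof (rule ccontr)
  fix u assume u: "u \<in> V" "\<not> dg u V \<le> k"
  have "closed_path [u]" using u by (simp add: closed_path_def is_path_def)
  then obtain v where "v \<in> V" "v \<notin> set [u]" "card (V - set [u]) \<le> 2 * dg v (V - set [u])"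
    by (rule bad_vertex)
  then have v: "v \<in> V" "v \<noteq> u" "card (V - {u}) \<le> 2 * dg v (V - {u})" by auto
  then have dv: "k \<le> dg v (V - {u})" using card_V u by simp
  have uv: "\<not> adj u v"
  proof
    assume uv: "adj u v"
    have "dg v V = Suc (dg v (V - {u}))"
      using u uv finite_V by (intro dg_remove_adj) (auto simp: adj_commute)
    then show False
      by (intro no_path[of "[u, v]" 1]) (use u v dv uv in \<open>auto simp: is_path_def adj_commute\<close>)
  qed
  then have dv': "k \<le> dg v V" using dv dg_remove_nonadj[of v u V] by (simp add: adj_commute)
  obtain z where z: "z \<in> V" "adj u z" "adj v z"
    by (rule common_nb[of u v]) (use u v uv dv' in auto)
  define W where "W = V - set [u, z, v]"
  have ne: "u \<noteq> z" "v \<noteq> z" using z by auto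
  have cW: "card W = 2 * k - 3"
    unfolding W_def using u v z ne card_V by (subst card_Diff_subset) auto
  have "card {u, z, v} \<le> card V" using u v z finite_V by (intro card_mono) auto
  then have k2: "2 \<le> k" using ne v card_V by simp
  have Wu: "k \<le> dg u W"
    using dg_Diff_list[of V u "[u, z, v]"] u uv z finite_V by (simp add: W_def)
  have Wv: "k \<le> Suc (dg v W)"
    using dg_Diff_list[of V v "[u, z, v]"] dv' uv z finite_V by (simp add: W_def adj_commute)
  show False
  proof (rule no_odd_chain[of u z "[v]" W "k - 2"])
    fix x y assume xy: "x \<in> nb u W" "y \<in> nb (hd [v]) W"
    show "\<not> adj x y"
    proof
      assume "adj x y"
      with xy show False
        by (intro no_path[of "[u, x, y, v]" 2])
           (use u v uv dv' in \<open>auto simp: is_path_def adj_commute W_def\<close>)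
    qed
  qed (use u v z ne uv cW k2 Wu Wv in \<open>auto simp: is_path_def W_def adj_commute\<close>)
qed

section \<open>Adjacency among the vertices of degree k\<close>

definition T :: "'a set" where
  "T = {t \<in> V. dg t V = k}"

lemma T_iff: "t \<in> T \<longleftrightarrow> t \<in> V \<and> dg t V = k"
  by (simp add: T_def)

lemma missing_T:
  assumes "x \<in> V"
  obtains t where "t \<in> T" "t \<noteq> x" "\<not> adj t x"
proof -
  have "closed_path [x]" using assms by (simp add: closed_path_def is_path_def)
  then obtain t where "t \<in> V" "t \<notin> set [x]" "card (V - set [x]) \<le> 2 * dg t (V - set [x])"
    by (rule bad_vertex)
  then have t: "t \<in> V" "t \<noteq> x" "card (V - {x}) \<le> 2 * dg t (V - {x})" by auto
  then have dt: "k \<le> dg t (V - {x})" using card_V assms by simp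
  have "\<not> adj t x"
  proof
    assume "adj t x"
    then have "dg t V = Suc (dg t (V - {x}))" using assms finite_V by (intro dg_remove_adj) auto
    then show False using dt degree_le[OF t(1)] by simp
  qed
  moreover from this have "dg t V = k" using dt dg_remove_nonadj[of t x V] degree_le[OF t(1)] by simp
  ultimately show thesis using that t by (auto simp: T_iff)
qed

lemma T_common_nb:
  assumes "a \<in> T" "b \<in> T" "a \<noteq> b" "\<not> adj a b"
  obtains y where "y \<in> V" "adj a y" "adj b y"
  by (rule common_nb[of a b]) (use assms in \<open>auto simp: T_iff\<close>)

text \<open>On the path \<open>a, p, q, b\<close> each end sees at most the two inner vertices, and
  by the last hypothesis one end sees only one of them.\<close>

lemma T_no_edge:
  assumes "a \<in> T" "b \<in> T" "a \<noteq> b" "\<not> adj a b" "p \<in> V" "q \<in> V" "adj a p" "adj b q" "adj p q"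
    and "\<not> adj a q \<or> \<not> adj b p"
  shows False
  by (rule no_path[of "[a, p, q, b]" 2])
     (use assms in \<open>auto simp: is_path_def T_iff adj_commute\<close>)

text \<open>This makes nonadjacency transitive on \<open>T\<close>, so that \<open>T\<close> induces
  a complete multipartite graph. A common neighbour of \<open>u\<close> and \<open>v\<close>
  supplies the forbidden path on four vertices.\<close>

lemma T_adj_cong_aux:
  assumes "u \<in> T" "v \<in> T" "u \<noteq> v" "\<not> adj u v" "t \<in> T" "adj t u"
  shows "adj t v"
proof (rule ccontr)
  assume tv: "\<not> adj t v"
  obtain y where y: "y \<in> V" "adj u y" "adj v y" using T_common_nb assms by blast
  show False
  proof (cases "adj t y")
    case True
    then show False using T_no_edge[of u v t y] assms y tv by (auto simp: T_iff adj_commute)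
  next
    case False
    show False
      by (rule no_path[of "[t, u, y, v]" 2])
         (use assms y tv False in \<open>auto simp: is_path_def T_iff adj_commute\<close>)
  qed
qed

lemma T_adj_cong:
  assumes "u \<in> T" "v \<in> T" "u \<noteq> v" "\<not> adj u v" "t \<in> T"
  shows "adj t u \<longleftrightarrow> adj t v"
  using T_adj_cong_aux[of u v t] T_adj_cong_aux[of v u t] assms by (auto simp: adj_commute)

text \<open>The path \<open>t, z, u, y, v\<close> falls under \<open>no_odd_chain\<close> with
  \<open>h = k - 3\<close>: an edge between neighbours of \<open>t\<close> and \<open>u\<close> off
  the path would give a forbidden path on four or six vertices.\<close>

lemma T_independent_triple:
  assumes T: "t \<in> T" "u \<in> T" "v \<in> T" "t \<noteq> u" "t \<noteq> v" "u \<noteq> v"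
    and nonadj: "\<not> adj t u" "\<not> adj t v" "\<not> adj u v"
    and y: "y \<in> V" "adj u y" "adj v y" "\<not> adj t y"
  shows False
proof -
  obtain z where z: "z \<in> V" "adj t z" "adj u z" using T_common_nb T nonadj by blast
  have V: "t \<in> V" "u \<in> V" "v \<in> V" "dg t V = k" "dg u V = k" "dg v V = k" using T by (auto simp: T_iff)
  have ne: "z \<noteq> y" "z \<noteq> t" "z \<noteq> u" "z \<noteq> v" "y \<noteq> t" "y \<noteq> u" "y \<noteq> v"
    using z y nonadj by (auto simp: adj_commute)
  note nonadj' = nonadj nonadj[unfolded adj_commute[of t] adj_commute[of u v]]
  define W where "W = V - set [t, z, u, y, v]"
  have cW: "card W = 2 * k - 5"
    unfolding W_def using V z y ne T card_V by (subst card_Diff_subset) auto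
  have "card (set [t, z, u, y, v]) \<le> card V" using V z y finite_V by (intro card_mono) auto
  moreover have "card (set [t, z, u, y, v]) = 5"
    using ne T by (subst distinct_card) auto
  ultimately have k3: "3 \<le> k" using card_V by simp
  have Wt: "k \<le> Suc (dg t W)"
    using dg_Diff_list[of V t "[t, z, u, y, v]"] finite_V V z y nonadj' by (simp add: W_def)
  have Wu: "k \<le> dg u W + 2"
    using dg_Diff_list[of V u "[t, z, u, y, v]"] finite_V V z y nonadj' by (simp add: W_def)
  have Wv: "k \<le> dg v W + 2"
    using dg_Diff_list[of V v "[t, z, u, y, v]"] finite_V V z y nonadj'
    by (simp add: W_def split: if_splits)
  show False
  proof (rule no_odd_chain[of t z "[u, y, v]" W "k - 3"])
    fix p q assume "p \<in> nb t W" "q \<in> nb (hd [u, y, v]) W"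
    then have pq: "p \<in> V" "q \<in> V" "adj t p" "adj u q"
      "p \<notin> {t, z, u, y, v}" "q \<notin> {t, z, u, y, v}" by (auto simp: W_def)
    show "\<not> adj p q"
    proof
      assume e: "adj p q"
      show False
      proof (cases "adj t q \<and> adj u p")
        case False
        then show False using T_no_edge[of t u p q] T nonadj pq e by blast
      next
        case True
        have lt: "length (filter (adj t) [t, p, q, u, y, v]) = 2" using True pq nonadj y by simp
        have lv: "length (filter (adj v) [t, p, q, u, y, v]) \<le> 3" using nonadj' by auto
        show False
        proof (rule no_path[of "[t, p, q, u, y, v]" 3])
          show "is_path [t, p, q, u, y, v]"
            using True pq V y e T ne by (auto simp: is_path_def adj_commute)
        qed (use lt lv V in auto)
      qed
    qed
  next
    show "is_path (t # z # [u, y, v])"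
      using V z y ne T by (auto simp: is_path_def adj_commute)
    show "k - 3 + 2 \<le> dg t W" "k - 3 + 1 \<le> dg (hd [u, y, v]) W" "k - 3 \<le> dg (last [u, y, v]) W"
      using Wt Wu Wv k3 by auto
    show "card W = 2 * (k - 3) + 1" using cW k3 by simp
  qed (auto simp: W_def)
qed

lemma T_missing_common_nb:
  assumes "u \<in> T" "v \<in> T" "u \<noteq> v" "\<not> adj u v" "y \<in> V" "adj u y" "adj v y" "t \<in> T" "\<not> adj t y"
  shows "adj t u" "adj t v"
proof -
  have "t \<noteq> u" "t \<noteq> v" using assms by auto
  then have "adj t u \<or> adj t v" using T_independent_triple[of t u v y] assms by blast
  then show "adj t u" "adj t v" using T_adj_cong[of u v t] assms by auto
qed

text \<open>Otherwise \<open>u, b, t, v\<close> is a forbidden path, since \<open>v\<close> sees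
  \<open>t\<close> but not \<open>b\<close>.\<close>

lemma T_mixed:
  assumes "u \<in> T" "v \<in> T" "u \<noteq> v" "\<not> adj u v" "b \<in> V" "adj b u" "\<not> adj b v" "t \<in> T" "adj t u"
  shows "\<not> adj b t"
  using T_no_edge[of u v b t] T_adj_cong[of u v t] assms by (auto simp: T_iff adj_commute)

text \<open>A bad vertex \<open>b\<close> of the triangle is not in \<open>T\<close>, as it would
  then see two corners and have degree above \<open>k\<close>. So it has degree \<open>k - 1\<close>
  and sees no corner, and a vertex of \<open>T\<close> that misses both \<open>b\<close> and a
  corner gives a forbidden path on six vertices.\<close>

lemma T_triangle_free:
  assumes T: "u \<in> T" "t \<in> T" "r \<in> T" and adj: "adj u t" "adj t r" "adj u r"
  shows False
proof -
  have V: "u \<in> V" "t \<in> V" "r \<in> V" using T by (auto simp: T_iff)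
  have ne: "u \<noteq> t" "t \<noteq> r" "u \<noteq> r" using adj by auto
  note adj' = adj adj[THEN adj_sym]
  have "closed_path [u, t, r]" using V ne adj' by (auto simp: closed_path_def is_path_def)
  then obtain b where b: "b \<in> V" "b \<notin> set [u, t, r]"
    and b2: "card (V - set [u, t, r]) \<le> 2 * dg b (V - set [u, t, r])" by (rule bad_vertex)
  have "card (V - set [u, t, r]) = 2 * k - 3" using V ne card_V by (subst card_Diff_subset) auto
  then have low: "k \<le> Suc (dg b (V - set [u, t, r]))" using b2 by simp
  have eq: "dg b V = dg b (V - set [u, t, r]) + length (filter (adj b) [u, t, r])"
  proof -
    have "nb b V = nb b (V - set [u, t, r]) \<union> set (filter (adj b) [u, t, r])" using V by auto
    moreover have "card (set (filter (adj b) [u, t, r])) = length (filter (adj b) [u, t, r])"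
      using ne by (intro distinct_card) simp
    ultimately show ?thesis unfolding dg_def
      using finite_V card_Un_disjoint[of "nb b (V - set [u, t, r])" "set (filter (adj b) [u, t, r])"]
      by force
  qed
  have bT: "b \<notin> T"
  proof
    assume bT: "b \<in> T"
    have bne: "u \<noteq> b" "t \<noteq> b" using b(2) by auto
    have "adj b u \<or> (adj b t \<and> adj b r)"
      using T_adj_cong_aux[OF T(1) bT bne(1) _ T(2)] T_adj_cong_aux[OF T(1) bT bne(1) _ T(3)]
        adj' adj_sym by blast
    moreover have "adj b t \<or> (adj b u \<and> adj b r)"
      using T_adj_cong_aux[OF T(2) bT bne(2) _ T(1)] T_adj_cong_aux[OF T(2) bT bne(2) _ T(3)]
        adj' adj_sym by blast
    ultimately show False using low eq bT by (auto simp: T_iff split: if_splits)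
  qed
  then have "dg b V < k" using degree_le[OF b(1)] b(1) by (auto simp: T_iff)
  then have db: "Suc (dg b V) = k" and bn: "\<not> adj b u" "\<not> adj b t" "\<not> adj b r"
    using low eq by (auto split: if_splits)
  have key: False
    if T': "u' \<in> T" "t' \<in> T" "r' \<in> T" "v' \<in> T" and adj': "adj u' t'" "adj t' r'" "adj u' r'"
      and v': "v' \<noteq> u'" "\<not> adj v' u'" "\<not> adj b v'" and bn': "\<not> adj b u'" "\<not> adj b t'" "\<not> adj b r'"
    for u' t' r' v'
  proof -
    have V': "u' \<in> V" "t' \<in> V" "r' \<in> V" "v' \<in> V" "dg u' V = k" "dg t' V = k" using T' by (auto simp: T_iff)
    have nb': "b \<noteq> u'" "b \<noteq> t'" "b \<noteq> r'" "b \<noteq> v'" using T' bT by auto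
    have vt: "adj t' v'" "adj v' r'"
      using T_adj_cong_aux[OF T'(1,4) _ _ T'(2)] T_adj_cong_aux[OF T'(1,4) _ _ T'(3)] adj' v' adj_sym by blast+
    obtain z where z: "z \<in> V" "adj b z" "adj t' z"
      by (rule common_nb[of b t']) (use b nb' bn' V' db in auto)
    have ne': "z \<noteq> v'" "z \<noteq> r'" "z \<noteq> u'" "z \<noteq> t'" "z \<noteq> b" "v' \<noteq> t'" "v' \<noteq> r'" "t' \<noteq> r'" "t' \<noteq> u'" "r' \<noteq> u'"
      using z v' bn' vt adj' by auto
    have l1: "length (filter (adj b) [b, z, t', v', r', u']) = 1" using z bn' v' by simp
    have l2: "length (filter (adj u') [b, z, t', v', r', u']) \<le> 3"
      using bn' v' by (auto simp: adj_commute)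
    show False
    proof (rule no_path[of "[b, z, t', v', r', u']" 3])
      show "is_path [b, z, t', v', r', u']"
        using b V' nb' ne' z vt adj' v' by (auto simp: is_path_def adj_commute)
    qed (use l1 l2 db V' in auto)
  qed
  obtain v where v: "v \<in> T" "v \<noteq> u" "\<not> adj v u" using missing_T[of u] V by blast
  obtain s where s: "s \<in> T" "s \<noteq> t" "\<not> adj s t" using missing_T[of t] V by blast
  show False
  proof (cases "adj b v")
    case False
    then show False using key[of u t r v] T v adj bn by blast
  next
    \<comment> \<open>When \<open>b\<close> sees \<open>v\<close>, the corner \<open>t\<close> and
      its nonneighbour \<open>s\<close> replace \<open>u\<close> and \<open>v\<close>.\<close>
    case True
    have "adj s u" using T_adj_cong_aux[of t s u] T s adj' adj_sym by blast
    then have "adj s v" using T_adj_cong_aux[of u v s] T s v adj_sym by blast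
    then have "\<not> adj b s" using T_mixed[of v u b s] T v s b True bn by blast
    then show False using key[of t u r s] T s adj' bn by blast
  qed
qed

section \<open>The bipartition given by adjacent vertices of degree k, and its growing cycle\<close>

lemma T_adjacent_partition:
  assumes T: "u \<in> T" "t \<in> T" "adj u t"
  shows "nb u V \<inter> nb t V = {}" "nb u V \<union> nb t V = V"
proof -
  show disj: "nb u V \<inter> nb t V = {}"
  proof (rule ccontr)
    assume "nb u V \<inter> nb t V \<noteq> {}"
    then obtain s where s: "s \<in> V" "adj u s" "adj t s" by auto
    obtain w where w: "w \<in> T" "w \<noteq> s" "\<not> adj w s" using missing_T s by blast
    \<comment> \<open>Whichever of \<open>u\<close> and \<open>t\<close> is missed by
      \<open>w\<close>, the vertex \<open>s\<close> distinguishes it from \<open>w\<close>, and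
      \<open>T_mixed\<close> denies the edge from \<open>s\<close> to the other one.\<close>
    have "\<not> adj w u \<or> \<not> adj w t"
      using T_triangle_free[of w u t] w T by blast
    moreover have "w \<noteq> u" "w \<noteq> t" using s w by auto
    ultimately show False
      using T_mixed[of u w s t] T_mixed[of t w s u] T s w adj_sym by blast
  qed
  then have "card (nb u V \<union> nb t V) = card V"
    using T finite_V card_V by (subst card_Un_disjoint) (auto simp: T_iff dg_def)
  then show "nb u V \<union> nb t V = V"
    using finite_V by (intro card_subset_eq) auto
qed

text \<open>The twins \<open>t'\<close> and \<open>t\<close> are the ends of the path
  \<open>t', u, p, b, y, t\<close> and see only \<open>u\<close> and \<open>y\<close> on it, one
  vertex fewer than is allowed for each.\<close>

lemma no_side_edge:
  assumes "nb u V = A" "nb t V = Y" "nb t' V = Y" "A \<inter> Y = {}" "u \<in> Y" "t \<in> A" "t' \<in> A" "t \<noteq> t'"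
    and "dg t V = k" "dg t' V = k"
    and "p \<in> A" "b \<in> A" "y \<in> Y" "y \<noteq> u" "adj b p" "adj b y"
  shows False
proof -
  have "A \<subseteq> V" "Y \<subseteq> V" using assms(1,2) nb_subset by blast+
  then have V: "u \<in> V" "t \<in> V" "t' \<in> V" "p \<in> V" "b \<in> V" "y \<in> V"
    using assms(5-7,11-13) by auto
  have tA: "\<not> adj t a" "\<not> adj t' a" if "a \<in> A" for a
  proof -
    have "a \<notin> nb t V" "a \<notin> nb t' V" using assms(2-4) that by auto
    then show "\<not> adj t a" "\<not> adj t' a" using that \<open>A \<subseteq> V\<close> by auto
  qed
  have tY: "adj t a" "adj t' a" if "a \<in> Y" for a
  proof -
    have "a \<in> nb t V" "a \<in> nb t' V" using assms(2,3) that by auto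
    then show "adj t a" "adj t' a" by auto
  qed
  have "p \<in> nb u V" using assms(1,11) by auto
  then have up: "adj u p" by auto
  have ne: "p \<noteq> t" "p \<noteq> t'" "b \<noteq> t" "b \<noteq> t'" "p \<noteq> b"
    using tA[OF assms(11)] tA[OF assms(12)] assms(15) by (auto simp: adj_commute)
  have ne2: "u \<notin> A" "y \<notin> A" using assms(4,5,13) by auto
  show False
  proof (rule no_path[of "[t', u, p, b, y, t]" 3])
    show "is_path [t', u, p, b, y, t]"
      using V ne ne2 assms(6-8,11,12,14-16) up tY[OF assms(5)] tY[OF assms(13)]
      by (auto simp: is_path_def adj_commute)
    have "length (filter (adj t') [t', u, p, b, y, t]) = 2" "length (filter (adj t) [t', u, p, b, y, t]) = 2"
      using tA[OF assms(6)] tA[OF assms(7)] tA[OF assms(11)] tA[OF assms(12)] tY[OF assms(5)] tY[OF assms(13)]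
      by auto
    then show "k + length (filter (adj (hd [t', u, p, b, y, t])) [t', u, p, b, y, t]) \<le> dg (hd [t', u, p, b, y, t]) V + 3"
      "k + length (filter (adj (last [t', u, p, b, y, t])) [t', u, p, b, y, t]) \<le> dg (last [t', u, p, b, y, t]) V + 3"
      "2 * k + length (filter (adj (hd [t', u, p, b, y, t])) [t', u, p, b, y, t]) +
        length (filter (adj (last [t', u, p, b, y, t])) [t', u, p, b, y, t])
        < dg (hd [t', u, p, b, y, t]) V + dg (last [t', u, p, b, y, t]) V + 2 * 3"
      using assms(9,10) by simp_all
  qed simp_all
qed

text \<open>The set \<open>A - {b}\<close> is too small for \<open>m\<close> neighbours, so
  \<open>b\<close> has one in \<open>Y\<close> and hence none in \<open>A\<close>; its neighbours
  then fill \<open>Y\<close>.\<close>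

lemma dominates_other_side:
  assumes fin: "finite A" "finite Y" and c: "card A = m" "card Y = m" and b: "b \<in> A" "m \<le> dg b (A \<union> Y)"
    and no: "\<forall>p\<in>A. \<forall>y\<in>Y. \<not> (adj b p \<and> adj b y)"
  shows "Y \<noteq> {}" "\<And>y. y \<in> Y \<Longrightarrow> adj b y"
proof -
  have m: "0 < m" using fin b c card_gt_0_iff[of A] by auto
  then show "Y \<noteq> {}" using c by auto
  have "nb b Y \<noteq> {}"
  proof
    assume "nb b Y = {}"
    then have "dg b (A \<union> Y) \<le> card (A - {b})" using fin by (intro dg_le_card_superset) auto
    then show False using b c m fin by simp
  qed
  then have "nb b A = {}" using no by fastforce
  then have "dg b (A \<union> Y) \<le> card (nb b Y)" using fin by (intro dg_le_card_superset) auto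
  then have "card Y \<le> card (nb b Y)" using b c by linarith
  then have "nb b Y = Y" by (rule card_seteq[OF fin(2) nb_subset])
  then show "adj b y" if "y \<in> Y" for y using that in_nb by metis
qed

text \<open>The twins \<open>u\<close>, \<open>v\<close> and \<open>t\<close>, \<open>s\<close> fix
  the two sides. From the edge \<open>t, u\<close> a closed path alternating between the sides keeps
  growing, because its bad vertex never fails to exist.\<close>

lemma inconsistent: False
proof -
  have "closed_path []" by (simp add: closed_path_def is_path_def)
  then obtain x where "x \<in> V" using bad_vertex by blast
  then obtain u where u: "u \<in> T" using missing_T by blast
  then obtain v where v: "v \<in> T" "v \<noteq> u" "\<not> adj v u" using missing_T[of u] by (auto simp: T_iff)
  then obtain y where y: "y \<in> V" "adj u y" "adj v y" using T_common_nb[of v u] u by blast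
  then obtain t where t: "t \<in> T" "t \<noteq> y" "\<not> adj t y" using missing_T by blast
  have tuv: "adj t u" "adj t v"
    using T_missing_common_nb[of u v y t] u v y t adj_sym by blast+
  obtain s where s: "s \<in> T" "s \<noteq> t" "\<not> adj s t" using missing_T[of t] t by (auto simp: T_iff)
  then have us: "adj u s" using T_adj_cong_aux[of t s u] u t tuv adj_sym by blast
  define A Y where "A = nb u V" and "Y = nb t V"
  have disj: "A \<inter> Y = {}" "A \<union> Y = V"
    using T_adjacent_partition[OF u t(1) adj_sym[OF tuv(1)]] unfolding A_def Y_def by blast+
  have nbv: "nb v V = A"
    using T_adjacent_partition[OF v(1) t(1) adj_sym[OF tuv(2)]] disj unfolding Y_def by blast
  have nbs: "nb s V = Y"
    using T_adjacent_partition[OF u s(1) us] disj unfolding A_def by blast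
  have nbu: "nb u V = A" and nbt: "nb t V = Y" by (simp_all add: A_def Y_def)
  have inV: "u \<in> V" "v \<in> V" "t \<in> V" "s \<in> V" and deg: "dg u V = k" "dg v V = k" "dg t V = k" "dg s V = k"
    using u v t s by (auto simp: T_iff)
  have mem: "u \<in> Y" "v \<in> Y" "t \<in> A" "s \<in> A" using inV tuv us by (auto simp: A_def Y_def adj_commute)
  have fin: "finite A" "finite Y" using finite_V by (auto simp: A_def Y_def)
  have cAY: "card A = k" "card Y = k" using deg by (auto simp: A_def Y_def dg_def)
  \<comment> \<open>The closing edge of \<open>c\<close> joins two vertices that dominate what is left of the opposite side,
    so a bad vertex and one of its neighbours can be inserted there.\<close>
  have chain: False
    if "n = card (A - set c)" "is_path c" "c \<noteq> []" "adj (last c) (hd c)" "{u, t} \<subseteq> set c"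
      "card (A - set c) = card (Y - set c)"
      "\<And>y. y \<in> Y - set c \<Longrightarrow> adj (hd c) y" "\<And>a. a \<in> A - set c \<Longrightarrow> adj (last c) a" for n c
    using that
  proof (induction n arbitrary: c rule: less_induct)
    case (less n c)
    note c = less.prems
    have "closed_path c" using c by (simp add: closed_path_def)
    then obtain b where b: "b \<in> V" "b \<notin> set c" "card (V - set c) \<le> 2 * dg b (V - set c)"
      by (rule bad_vertex)
    have R: "V - set c = (A - set c) \<union> (Y - set c)" using disj by auto
    have "card (V - set c) = card (A - set c) + card (Y - set c)"
      unfolding R using fin disj by (intro card_Un_disjoint) auto
    then have db: "n \<le> dg b ((A - set c) \<union> (Y - set c))" using b(3) c(1,6) unfolding R by simp
    have fin': "finite (A - set c)" "finite (Y - set c)" using fin by auto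
    consider "b \<in> A - set c" | "b \<in> Y - set c" using b disj by auto
    then show False
    proof cases
      case 1
      have no: "\<forall>p\<in>A - set c. \<forall>q\<in>Y - set c. \<not> (adj b p \<and> adj b q)"
      proof (intro ballI notI)
        fix p q assume pq: "p \<in> A - set c" "q \<in> Y - set c" "adj b p \<and> adj b q"
        show False
          by (rule no_side_edge[OF nbu nbt nbs disj(1) mem(1,3,4) s(2)[symmetric] deg(3,4), of p b q])
             (use pq 1 c(5) in auto)
      qed
      note full = dominates_other_side[OF fin' c(1)[symmetric] c(6)[symmetric, folded c(1)] 1 db no]
      obtain y where y: "y \<in> Y - set c" using full(1) by blast
      have yb: "y \<noteq> b" "y \<in> V" "y \<notin> A" using y 1 disj by auto
      show False
      proof (rule less.IH[of "card (A - set (b # y # c))" "b # y # c"])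
        have "A - set (b # y # c) \<subset> A - set c" using 1 by auto
        then show "card (A - set (b # y # c)) < n" unfolding c(1) using fin psubset_card_mono by blast
        show "is_path (b # y # c)"
          using c(2,3) c(7)[OF y] full(2)[OF y] b yb y
          by (auto simp: is_path_def successively_Cons adj_commute)
        show "adj (last (b # y # c)) (hd (b # y # c))" using c(3) c(8)[OF 1] by simp
        have "A - set (b # y # c) = A - set c - {b}" "Y - set (b # y # c) = Y - set c - {y}"
          using yb 1 disj by auto
        then show "card (A - set (b # y # c)) = card (Y - set (b # y # c))"
          using c(6) 1 y by simp
        show "adj (hd (b # y # c)) y'" if "y' \<in> Y - set (b # y # c)" for y' using full(2)[of y'] that by simp
        show "adj (last (b # y # c)) a" if "a \<in> A - set (b # y # c)" for a using c(3) c(8)[of a] that by simp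
      qed (use c(5) in auto)
    next
      \<comment> \<open>Mirror image: the twins used are \<open>u\<close> and \<open>v\<close>, and
        the new pair is appended instead of prepended.\<close>
      case 2
      have no: "\<forall>p\<in>Y - set c. \<forall>q\<in>A - set c. \<not> (adj b p \<and> adj b q)"
      proof (intro ballI notI)
        fix p q assume pq: "p \<in> Y - set c" "q \<in> A - set c" "adj b p \<and> adj b q"
        show False
          by (rule no_side_edge[OF nbt nbu nbv disj(1)[unfolded Int_commute[of A]] mem(3,1,2) v(2)[symmetric] deg(1,2), of p b q])
             (use pq 2 c(5) in auto)
      qed
      note full = dominates_other_side[OF fin'(2,1) c(6)[symmetric, folded c(1)] c(1)[symmetric] 2
          db[unfolded Un_commute[of "A - set c"]] no]
      obtain a where a: "a \<in> A - set c" using full(1) by blast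
      have ab: "a \<noteq> b" "a \<in> V" "a \<notin> Y" using a 2 disj by auto
      show False
      proof (rule less.IH[of "card (A - set (c @ [a, b]))" "c @ [a, b]"])
        have "A - set (c @ [a, b]) \<subset> A - set c" using a by auto
        then show "card (A - set (c @ [a, b])) < n" unfolding c(1) using fin psubset_card_mono by blast
        show "is_path (c @ [a, b])"
          using c(2,3) c(8)[OF a] full(2)[OF a] b ab a
          by (auto simp: is_path_def successively_append_iff adj_commute)
        show "adj (last (c @ [a, b])) (hd (c @ [a, b]))" using c(3) c(7)[OF 2] by (simp add: adj_commute)
        have "A - set (c @ [a, b]) = A - set c - {a}" "Y - set (c @ [a, b]) = Y - set c - {b}"
          using ab 2 disj by auto
        then show "card (A - set (c @ [a, b])) = card (Y - set (c @ [a, b]))"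
          using c(6) 2 a by simp
        show "adj (hd (c @ [a, b])) y'" if "y' \<in> Y - set (c @ [a, b])" for y' using c(3) c(7)[of y'] that by simp
        show "adj (last (c @ [a, b])) a'" if "a' \<in> A - set (c @ [a, b])" for a' using full(2)[of a'] that by simp
      qed (use c(5) in auto)
    qed
  qed
  show False
  proof -
    have e: "A - set [t, u] = A - {t}" "Y - set [t, u] = Y - {u}" using mem disj by auto
    have "card (A - set [t, u]) = card (Y - set [t, u])" unfolding e using mem cAY by simp
    moreover have "is_path [t, u]" using inV tuv by (auto simp: is_path_def)
    moreover have "adj (hd [t, u]) y" if "y \<in> Y" for y using that by (simp add: Y_def)
    moreover have "adj (last [t, u]) a" if "a \<in> A" for a using that by (simp add: A_def)
    ultimately show False
      using adj_sym[OF tuv(1)] chain[of "card (A - set [t, u])" "[t, u]"] by simp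
  qed
qed

end

lemma (in counterexample) inconsistent: False
proof -
  obtain k where k: "card V = 2 * k" using even_card by (rule evenE)
  interpret even_counterexample V adj k by unfold_locales (fact k)
  show False by (rule inconsistent)
qed

section \<open>From vertex lists to subgraphs\<close>

text \<open>The cyclic successor relation. A list of length 1 gives the pair \<open>(x, x)\<close>,
  which no arc of a loopless graph matches.\<close>

definition cycle_pairs :: "'a list \<Rightarrow> ('a \<times> 'a) set" where
  "cycle_pairs c = set (zip c (tl c @ [hd c]))"

definition cycle_subgraph :: "('a, 'b) pre_digraph \<Rightarrow> 'a list \<Rightarrow> ('a, 'b) pre_digraph" where
  "cycle_subgraph G c =
     \<lparr>verts = set c, arcs = {e \<in> arcs G. arc_to_ends G e \<in> cycle_pairs c \<union> (cycle_pairs c)\<inverse>},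
      tail = tail G, head = head G\<rparr>"

lemma cycle_pairs_subset: "cycle_pairs c \<subseteq> set c \<times> set c"
proof
  fix xy assume "xy \<in> cycle_pairs c"
  then have xy: "(fst xy, snd xy) \<in> set (zip c (tl c @ [hd c]))" by (simp add: cycle_pairs_def)
  then have "c \<noteq> []" by auto
  then have "set (tl c @ [hd c]) \<subseteq> set c" by (auto dest: list.set_sel(2))
  then show "xy \<in> set c \<times> set c"
    using set_zip_leftD[OF xy] set_zip_rightD[OF xy] by (auto simp: mem_Times_iff)
qed

lemma successively_zip:
  assumes "successively R xs" "xs \<noteq> []" "R (last xs) z"
  shows "\<forall>(x, y) \<in> set (zip xs (tl xs @ [z])). R x y"
  using assms by (induction xs rule: induct_list012) auto

section \<open>Cycles and degrees in the digraph encoding\<close>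

context graph
begin

lemma finite_graph_verts: "finite_graph (verts G) (dominates G)"
  by unfold_locales (auto dest: graph_symmetric adj_not_same)

lemma graph_cycle_subgraph: "graph (cycle_subgraph G c)"
proof
  show "symmetric (cycle_subgraph G c)"
    unfolding symmetric_conv
  proof
    fix e assume "e \<in> arcs (cycle_subgraph G c)"
    then have e: "e \<in> arcs G" "(tail G e, head G e) \<in> cycle_pairs c \<union> (cycle_pairs c)\<inverse>"
      by (auto simp: cycle_subgraph_def arc_to_ends_def)
    then obtain e' where "e' \<in> arcs G" "tail G e = head G e'" "head G e = tail G e'"
      using sym_arcs unfolding symmetric_conv by blast
    with e show "\<exists>e' \<in> arcs (cycle_subgraph G c). tail (cycle_subgraph G c) e = head (cycle_subgraph G c) e' \<and>
        head (cycle_subgraph G c) e = tail (cycle_subgraph G c) e'"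
      by (intro bexI[of _ e']) (auto simp: cycle_subgraph_def arc_to_ends_def)
  qed
qed (use cycle_pairs_subset[of c] no_multi_arcs no_loops in
      \<open>auto simp: cycle_subgraph_def arc_to_ends_def\<close>)

lemma subgraph_cycle_subgraph:
  assumes "set c \<subseteq> verts G"
  shows "subgraph (cycle_subgraph G c) G"
  using assms graph_cycle_subgraph[of c] wf_digraph
  by (auto simp: subgraph_def compatible_def cycle_subgraph_def graph_def digraph_def fin_digraph_def)

lemma arcs_ends_cycle_subgraph:
  "arcs_ends (cycle_subgraph G c) = arcs_ends G \<inter> (cycle_pairs c \<union> (cycle_pairs c)\<inverse>)"
  by (auto simp: arcs_ends_def cycle_subgraph_def arc_to_ends_def image_iff)

lemma cas_zip:
  assumes "xs \<noteq> []" "\<forall>(x, y) \<in> set (zip xs (tl xs @ [z])). tail G (f (x, y)) = x \<and> head G (f (x, y)) = y"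
  shows "cas (hd xs) (map f (zip xs (tl xs @ [z]))) z"
  using assms by (induction xs rule: induct_list012) auto

text \<open>Choosing one arc for each cyclic pair gives the arc list \<open>p\<close>. Its walk
  properties are computed in \<open>G\<close> and transfer because the subgraph keeps the tail and
  head maps.\<close>

lemma proper_cycle_cycle_subgraph:
  assumes c: "distinct c" "3 \<le> length c" and pairs: "cycle_pairs c \<subseteq> arcs_ends G"
  shows "proper_cycle (cycle_subgraph G c)"
proof -
  let ?C = "cycle_subgraph G c"
  have "\<forall>xy\<in>cycle_pairs c. \<exists>e\<in>arcs G. arc_to_ends G e = xy"
    using pairs unfolding arcs_ends_def by blast
  then obtain f where f: "\<And>xy. xy \<in> cycle_pairs c \<Longrightarrow> f xy \<in> arcs G \<and> arc_to_ends G (f xy) = xy"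
    by metis
  define p where "p = map f (zip c (tl c @ [hd c]))"
  have ne: "c \<noteq> []" using c by auto
  have set_p: "set p = f ` cycle_pairs c" by (simp add: p_def cycle_pairs_def)
  have len: "length (tl c @ [hd c]) = length c" using ne by simp
  have f': "tail G (f xy) = fst xy" "head G (f xy) = snd xy" if "xy \<in> cycle_pairs c" for xy
    using f[OF that] unfolding arc_to_ends_def by (metis fst_conv, metis snd_conv)
  have cas: "cas (hd c) p (hd c)"
    unfolding p_def by (rule cas_zip[OF ne]) (use f' in \<open>auto simp: cycle_pairs_def\<close>)
  have heads: "map (head G) p = tl c @ [hd c]"
  proof -
    have "map (head G) p = map snd (zip c (tl c @ [hd c]))"
      unfolding p_def using f' by (auto simp: cycle_pairs_def)
    then show ?thesis using len by simp
  qed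
  have comp: "compatible G ?C" by (simp add: compatible_def cycle_subgraph_def)
  have p_ne: "p \<noteq> []" using ne by (auto simp: p_def)
  have tl_set: "set (tl c @ [hd c]) = set c" "distinct (tl c @ [hd c])"
    using ne c(1) by (cases c; auto)+
  have "set p \<subseteq> arcs ?C"
    using f by (auto simp: set_p cycle_subgraph_def)
  then have "pre_digraph.awalk ?C (hd c) p (hd c)"
    unfolding pre_digraph.awalk_def using cas ne
    by (simp add: compatible_cas[OF comp, symmetric]) (simp add: cycle_subgraph_def)
  moreover have "distinct (tl (pre_digraph.awalk_verts ?C (hd c) p))"
    using awalk_verts_conv'[OF cas] p_ne heads tl_set by (simp add: compatible_awalk_verts[OF comp, symmetric])
  ultimately have "pre_digraph.cycle ?C p"
    unfolding pre_digraph.cycle_def using p_ne by blast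
  moreover have "3 \<le> length p" using c ne by (simp add: p_def)
  moreover have "verts ?C = head ?C ` set p"
    using arg_cong[OF heads, of set] tl_set by (simp add: cycle_subgraph_def)
  moreover have ends_p: "arc_to_ends ?C ` set p = cycle_pairs c"
  proof -
    have "arc_to_ends ?C ` set p = (\<lambda>xy. arc_to_ends G (f xy)) ` cycle_pairs c"
      by (simp add: set_p image_image arc_to_ends_def cycle_subgraph_def)
    also have "\<dots> = (\<lambda>xy. xy) ` cycle_pairs c" using f by (intro image_cong) auto
    finally show ?thesis by simp
  qed
  moreover have "arcs_ends ?C = cycle_pairs c \<union> (cycle_pairs c)\<inverse>"
    using pairs graph_symmetric by (auto simp: arcs_ends_cycle_subgraph)
  ultimately show ?thesis
    unfolding proper_cycle_def using graph_cycle_subgraph by metis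
qed

lemma is_cycle_cycle_subgraph:
  assumes "finite_graph.closed_path (verts G) (dominates G) c"
  shows "is_cycle (cycle_subgraph G c)" "subgraph (cycle_subgraph G c) G"
proof -
  interpret finite_graph "verts G" "dominates G" by (rule finite_graph_verts)
  from assms have c: "distinct c" "set c \<subseteq> verts G" "successively (dominates G) c"
    and closed: "length c \<le> 1 \<or> dominates G (last c) (hd c)"
    by (auto simp: closed_path_def is_path_def)
  show "subgraph (cycle_subgraph G c) G" using c(2) by (rule subgraph_cycle_subgraph)
  note g = graph_cycle_subgraph[of c]
  have "length c = 0 \<or> length c = Suc 0 \<or> length c = Suc (Suc 0) \<or> 3 \<le> length c" by arith
  then consider "c = []" | x where "c = [x]" | x y where "c = [x, y]" | "3 \<le> length c"
    by (metis length_0_conv length_Suc_conv)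
  then show "is_cycle (cycle_subgraph G c)"
  proof cases
    case 1
    then have "empty_graph (cycle_subgraph G c)"
      using g by (simp add: empty_graph_def cycle_subgraph_def cycle_pairs_def)
    then show ?thesis by (simp add: is_cycle_def)
  next
    case (2 x)
    have "arc_to_ends G e \<noteq> (x, x)" if "e \<in> arcs G" for e
      using no_loops[OF that] by (auto simp: arc_to_ends_def)
    moreover have "cycle_pairs c \<union> (cycle_pairs c)\<inverse> = {(x, x)}"
      using 2 by (auto simp: cycle_pairs_def)
    ultimately have "arcs (cycle_subgraph G c) = {}"
      unfolding cycle_subgraph_def by simp
    moreover have "verts (cycle_subgraph G c) = {x}" using 2 by (simp add: cycle_subgraph_def)
    ultimately have "single_vertex (cycle_subgraph G c)"
      unfolding single_vertex_def using g by blast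
    then show ?thesis by (simp add: is_cycle_def)
  next
    case (3 x y)
    have "(x, y) \<in> arcs_ends G" "(y, x) \<in> arcs_ends G" using c(3) closed 3 by simp_all
    moreover have "cycle_pairs c \<union> (cycle_pairs c)\<inverse> = {(x, y), (y, x)}"
      using 3 by (auto simp: cycle_pairs_def)
    ultimately have "arcs_ends (cycle_subgraph G c) = {(x, y), (y, x)}"
      unfolding arcs_ends_cycle_subgraph by blast
    moreover have "verts (cycle_subgraph G c) = {x, y}" "x \<noteq> y"
      using 3 c(1) by (simp_all add: cycle_subgraph_def)
    ultimately have "single_edge (cycle_subgraph G c)"
      unfolding single_edge_def using g by blast
    then show ?thesis by (simp add: is_cycle_def)
  next
    case 4
    have "c \<noteq> []" using 4 by auto
    moreover have "\<not> length c \<le> 1" using 4 by simp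
    with closed have "dominates G (last c) (hd c)" by blast
    ultimately have "\<forall>(x, y)\<in>set (zip c (tl c @ [hd c])). dominates G x y"
      by (rule successively_zip[OF c(3)])
    then have "cycle_pairs c \<subseteq> arcs_ends G" unfolding cycle_pairs_def by auto
    then have "proper_cycle (cycle_subgraph G c)"
      by (rule proper_cycle_cycle_subgraph[OF c(1) 4])
    then show ?thesis by (simp add: is_cycle_def)
  qed
qed

text \<open>Without parallel arcs, \<open>head G\<close> is injective on the arcs leaving
  \<open>x\<close>, so counting arcs amounts to counting neighbours.\<close>

lemma out_degree_induce_subgraph:
  assumes "x \<in> S"
  shows "out_degree (G \<restriction> S) x = finite_graph.dg (dominates G) x S"
proof -
  interpret finite_graph "verts G" "dominates G" by (rule finite_graph_verts)
  have "bij_betw (head G) (out_arcs (G \<restriction> S) x) (nb x S)"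
    unfolding bij_betw_def
  proof
    show "inj_on (head G) (out_arcs (G \<restriction> S) x)"
      by (rule inj_onI) (auto simp: induce_subgraph_def arc_to_ends_def intro: no_multi_arcs)
    show "head G ` out_arcs (G \<restriction> S) x = nb x S"
    proof (intro equalityI subsetI)
      fix y assume "y \<in> head G ` out_arcs (G \<restriction> S) x"
      then obtain e where "e \<in> arcs G" "tail G e = x" "head G e = y" "y \<in> S"
        by (auto simp: induce_subgraph_def)
      then show "y \<in> nb x S" using in_arcs_imp_in_arcs_ends[of e] by simp
    next
      fix y assume "y \<in> nb x S"
      then have y: "y \<in> S" "dominates G x y" by simp_all
      from y(2) obtain e where "e \<in> arcs G" "tail G e = x" "head G e = y" by (rule reachableE)
      with y(1) assms have "e \<in> out_arcs (G \<restriction> S) x" "head G e = y"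
        by (simp_all add: induce_subgraph_def)
      then show "y \<in> head G ` out_arcs (G \<restriction> S) x" by blast
    qed
  qed
  then show ?thesis unfolding out_degree_def dg_def by (rule bij_betw_same_card)
qed

end

theorem theorem1p3:
  fixes G :: "('a, 'b) pre_digraph"
  assumes "graph G"
  shows "\<exists>C. subgraph C G \<and> is_cycle C \<and>
    (graph_order (graph_minus G C) = 0 \<or>
     real (max_degree (graph_minus G C)) \<le> 1 / 2 * (real (graph_order (graph_minus G C)) - 1))"
proof (rule ccontr)
  assume neg: "\<not> ?thesis"
  interpret graph G by fact
  interpret finite_graph "verts G" "dominates G" by (rule finite_graph_verts)
  \<comment> \<open>Every closed path is realized by a cycle subgraph with the same vertices, for
    which the negated claim supplies a bad vertex of maximum degree.\<close>
  interpret counterexample "verts G" "dominates G"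
  proof
    fix c assume c: "closed_path c"
    let ?S = "verts G - set c"
    have H: "graph_minus G (cycle_subgraph G c) = G \<restriction> ?S"
      by (simp add: graph_minus_def cycle_subgraph_def)
    have vS: "verts (G \<restriction> ?S) = ?S" by (simp add: induce_subgraph_def)
    have "\<not> (graph_order (G \<restriction> ?S) = 0 \<or>
        real (max_degree (G \<restriction> ?S)) \<le> 1 / 2 * (real (graph_order (G \<restriction> ?S)) - 1))"
      using neg is_cycle_cycle_subgraph[OF c] unfolding H[symmetric] by blast
    then have "card ?S \<noteq> 0" and big: "real (card ?S) - 1 < 2 * real (max_degree (G \<restriction> ?S))"
      unfolding graph_order_def vS by auto
    then have "?S \<noteq> {}" by auto
    then have "max_degree (G \<restriction> ?S) \<in> out_degree (G \<restriction> ?S) ` ?S"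
      unfolding max_degree_def vS by (intro Max_in) auto
    then obtain x where x: "x \<in> ?S" "max_degree (G \<restriction> ?S) = dg x ?S"
      using out_degree_induce_subgraph by auto
    with big have "card ?S \<le> 2 * dg x ?S" by linarith
    with x show "\<exists>x\<in>?S. card ?S \<le> 2 * dg x ?S" by blast
  qed
  show False by (rule inconsistent)
qed

end
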